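(* Let $\varepsilon_n$ be a sequence of positive numbers such that $\varepsilon_n\to0$ and $n\varepsilon_n^2\to\infty$. Assume the following conditions hold for this $\varepsilon_n$. (S2) There exists $S^\dagger=S_n^\dagger\in\mathcal{S}_n$ (deterministic), with $|S^\dagger|\le n\varepsilon_n^2$, and an associated deterministic $\theta^\dagger=\theta_n^\dagger\in\Theta_{n,S^\dagger}$ such that $\max\{K(p_{\theta^\star}^n,p_{\theta^\dagger}^n),\,V(p_{\theta^\star}^n,p_{\theta^\dagger}^n)\}\le n\varepsilon_n^2$ for all large $n$. (LP2) There exist constants $d>0$, $A>0$ and $C>0$ such that, with $S^\dagger$ as in (S2) and $\mathcal{L}_{n,S}=\{\theta\in\Theta_{n,S}: L_n(\theta)\ge e^{-d|S|}L_n(\hat\theta_{n,S})\}$, as $n\to\infty$, $$\mathsf{P}_{\theta^\star}^n\{\Pi_{n,S^\dagger}(\mathcal{L}_{n,S^\dagger})<e^{-Cn\varepsilon_n^2}\}\to0\quad\text{and}\quad w_n(S^\dagger)\gtrsim e^{-An\varepsilon_n^2}.$$ (GP2) There exist constants $K\ge0$ and $p>1$ such that $$\sum_{S\in\mathcal{S}_n}w_n(S)\int_{\Theta_{n,S}}\bigl[\mathsf{E}_{\theta^\star}^n\{\pi_{n,S}(\theta)^p\}\bigr]^{1/p}\,\nu_{n,S}(d\theta)\lesssim e^{Kn\varepsilon_n^2},\quad\text{all large }n.$$ For the constant $p>1$ in (GP2), take any $\alpha\in(0,1-p^{-1})$. Let $\Pi^n$ be the posterior distribution based on the double empirical prior $\widetilde\Pi_n$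 with either Type 1 or Type 2 regularization with this $\alpha$ (defined in the context). Then there exists $M>0$ such that $\mathsf{E}_{\theta^\star}^n\{\Pi^n(A_{M\varepsilon_n})\}\to0$ as $n\to\infty$.
   Context: For each $n\ge1$, $X^n$ denotes data (not necessarily iid or independent) with joint distribution $\mathsf{P}_\theta^n$ having density $p_\theta^n$ with respect to a dominating measure $\mu$, indexed by $\theta\in\Theta$ (possibly infinite-dimensional). $\theta^\star$ is the true parameter value and $\mathsf{E}_{\theta^\star}^n$ is expectation under $\mathsf{P}_{\theta^\star}^n$. The likelihood is $L_n(\theta)=p_\theta^n(X^n)$, and $R_n(\theta)=L_n(\theta)/L_n(\theta^\star)$. For densities $f,g$: $K(f,g)=\int\log(f/g)f\,d\mu$, $V(f,g)=\int\log^2(f/g)f\,d\mu$, $H^2(f,g)=\frac12\int(f^{1/2}-g^{1/2})^2d\mu$. The notation $a_n\gtrsim b_n$ ($a_n\lesssim b_n$) means inequality up to a positive multiplicative constant not depending on $n$. The parameter is represented as a pair $(S,\theta_S)$, where $S$ is a model index in a finite set $\mathcal{S}_n$ and $\theta_S\in\Theta_{n,S}$ is the model parameter; each $\Theta_{n,S}\subseteq\Theta$ is finite-dimensional with dimension (complexity) $|S|$, and the sieve is $\Theta_n=\bigcup_{S\in\mathcal{S}_n}\Theta_{n,S}$. $\hat\theta_{n,S}$ is the maximum likelihood estimator over $\Theta_{n,S}$, i.e. a maximizer of $L_n$ over $\Theta_{n,S}$. Let $w_n$ be a (data-independent) probability mass function on $\mathcal{S}_n$; for each $S$ let $\nu_{n,S}$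 be a data-independent measure on $\Theta_{n,S}$ (e.g., Lebesgue) and let $\Pi_{n,S}$ be a probability measure on $\Theta_{n,S}$, allowed to depend on the data $X^n$, with density $\pi_{n,S}$ with respect to $\nu_{n,S}$. The empirical prior is $\Pi_n(A)=\sum_{S\in\mathcal{S}_n}w_n(S)\,\Pi_{n,S}(A\cap\Theta_{n,S})$, $A\subseteq\Theta_n$. Double empirical priors, for $\alpha\in(0,1)$: Type 1 regularization: $\widetilde\Pi_n(d\theta)\propto \Pi_n(d\theta)/L_n(\theta)^{1-\alpha}$. Type 2 regularization: $\widetilde\Pi_n(A)=\sum_{S\in\mathcal{S}_n}\widetilde w_n(S)\,\Pi_{n,S}(A\cap\Theta_{n,S})$, where $\widetilde w_n(S)\propto w_n(S)/L_n(\hat\theta_{n,S})^{1-\alpha}$, $S\in\mathcal{S}_n$. In either case the posterior is $$\Pi^n(A)=\frac{\int_A R_n(\theta)\,\widetilde\Pi_n(d\theta)}{\int_{\Theta_n}R_n(\theta)\,\widetilde\Pi_n(d\theta)},\quad A\subseteq\Theta_n.$$ For $M>0$, $A_{M\varepsilon_n}=\{\theta:H^2(p_{\theta^\star}^n,p_\theta^n)>1-e^{-M^2n\varepsilon_n^2}\}$ (intersected with $\Theta_n$).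
   Formalization: The measures ν_{n,S} and μ are taken σ-finite, and likelihoods and prior densities jointly measurable (maximized likelihood measurable); for arbitrary ν_{n,S} the claim fails, e.g. counting measure on an uncountable model with Π_{n,S} a point mass at the MLE. *)

theory Defs
  imports "HOL-Probability.Probability"
begin

section \<open>Divergences between densities\<close>

text \<open>
  The logarithm of a likelihood ratio is extended-real valued: \<^term>\<open>ln (a / b)\<close> on the
  reals would give the value 0 at \<open>b = 0\<close>, and a Bochner integral would give the value 0 for
  a non-integrable function, so both the integrand and the integrals below are taken in the
  extended reals.  The value at \<open>a = 0\<close> is immaterial, since it is always multiplied by
  \<open>a = 0\<close>.
\<close>

definition log_ratio :: "real \<Rightarrow> real \<Rightarrow> ereal" where
  "log_ratio a b = (if a = 0 then - \<infinity> else if b = 0 then \<infinity> else ereal (ln (a / b)))"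

text \<open>
  In \<open>KL\<close> the two terms are the integrals of the positive and of the negative part
  (\<^const>\<open>e2ennreal\<close> sends negative arguments to 0); for probability densities the second
  one is finite.
\<close>

definition KL :: "'x measure \<Rightarrow> ('x \<Rightarrow> real) \<Rightarrow> ('x \<Rightarrow> real) \<Rightarrow> ereal" where
  "KL M f g =
     enn2ereal (\<integral>\<^sup>+x. e2ennreal (log_ratio (f x) (g x)) * ennreal (f x) \<partial>M) -
     enn2ereal (\<integral>\<^sup>+x. e2ennreal (- log_ratio (f x) (g x)) * ennreal (f x) \<partial>M)"

definition KL_var :: "'x measure \<Rightarrow> ('x \<Rightarrow> real) \<Rightarrow> ('x \<Rightarrow> real) \<Rightarrow> ennreal" where
  "KL_var M f g = (\<integral>\<^sup>+x. (e2ennreal \<bar>log_ratio (f x) (g x)\<bar>)\<^sup>2 * ennreal (f x) \<partial>M)"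

definition hellinger_sq :: "'x measure \<Rightarrow> ('x \<Rightarrow> real) \<Rightarrow> ('x \<Rightarrow> real) \<Rightarrow> real" where
  "hellinger_sq M f g = (1 / 2) * (\<integral>x. (sqrt (f x) - sqrt (g x))\<^sup>2 \<partial>M)"


section \<open>Priors and posteriors on a union of models\<close>

text \<open>
  The root \<open>y\<close> to the power \<open>1 / p\<close> of an extended nonnegative real, for \<open>p > 0\<close>.
\<close>

definition ennroot :: "real \<Rightarrow> ennreal \<Rightarrow> ennreal" where
  "ennroot p y = (if y = \<top> then \<top> else ennreal (enn2real y powr (1 / p)))"

text \<open>
  The measure \<open>A \<mapsto> (\<Sum>S\<in>I. wt S * Q S (A \<inter> \<Theta>\<^sub>S))\<close> on the union of the
  (possibly overlapping) sets \<open>\<Theta>\<^sub>S = space (Q S)\<close>.  A set is measurable iff its trace on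
  each \<open>\<Theta>\<^sub>S\<close> is.
\<close>

definition mixture_measure :: "'s set \<Rightarrow> ('s \<Rightarrow> ennreal) \<Rightarrow> ('s \<Rightarrow> 'a measure) \<Rightarrow> 'a measure" where
  "mixture_measure I wt Q =
     measure_of (\<Union>S\<in>I. space (Q S))
       {A. A \<subseteq> (\<Union>S\<in>I. space (Q S)) \<and> (\<forall>S\<in>I. A \<inter> space (Q S) \<in> sets (Q S))}
       (\<lambda>A. \<Sum>S\<in>I. wt S * emeasure (Q S) (A \<inter> space (Q S)))"

text \<open>
  Proportionality is read literally, as equality up to some constant \<open>c\<close> strictly between 0
  and infinity; the posterior does not depend on \<open>c\<close>.  Division is that of \<^typ>\<open>ennreal\<close>,
  so a vanishing likelihood gives density (or weight) infinity; this does not contribute to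
  integrals of the likelihood ratio because \<open>0 * \<infinity> = 0\<close>.
\<close>

definition type1_prior ::
  "real \<Rightarrow> 's set \<Rightarrow> ('s \<Rightarrow> real) \<Rightarrow> ('s \<Rightarrow> 'a measure) \<Rightarrow> ('a \<Rightarrow> real) \<Rightarrow> 'a measure \<Rightarrow> bool" where
  "type1_prior \<alpha> I w Q L P \<longleftrightarrow>
     (\<exists>c. 0 < c \<and> c < \<top> \<and>
        P = scale_measure c
              (density (mixture_measure I (\<lambda>S. ennreal (w S)) Q)
                 (\<lambda>\<theta>. 1 / ennreal (L \<theta> powr (1 - \<alpha>)))))"

definition type2_prior ::
  "real \<Rightarrow> 's set \<Rightarrow> ('s \<Rightarrow> real) \<Rightarrow> ('s \<Rightarrow> 'a measure) \<Rightarrow> ('s \<Rightarrow> real) \<Rightarrow> 'a measure \<Rightarrow> bool" where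
  "type2_prior \<alpha> I w Q Lmax P \<longleftrightarrow>
     (\<exists>c wt. 0 < c \<and> c < \<top> \<and>
        (\<forall>S\<in>I. wt S = c * (ennreal (w S) / ennreal (Lmax S powr (1 - \<alpha>)))) \<and>
        P = mixture_measure I wt Q)"

definition posterior :: "'a measure \<Rightarrow> ('a \<Rightarrow> real) \<Rightarrow> 'a set \<Rightarrow> ennreal" where
  "posterior P R A =
     (\<integral>\<^sup>+\<theta>\<in>A. ennreal (R \<theta>) \<partial>P) / (\<integral>\<^sup>+\<theta>. ennreal (R \<theta>) \<partial>P)"


section \<open>The statistical setting\<close>

text \<open>
  A space has dimension \<open>d\<close> if it is described by \<open>d\<close> free real coordinates.
\<close>

definition has_dimension :: "'a topology \<Rightarrow> nat \<Rightarrow> bool" where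
  "has_dimension X d \<longleftrightarrow>
     (\<exists>U \<subseteq> topspace (Euclidean_space d). Euclidean_space d interior_of U \<noteq> {} \<and>
        X homeomorphic_space subtopology (Euclidean_space d) U)"

text \<open>
  Everything is indexed by \<open>n \<ge> 1\<close>; values at \<open>n = 0\<close> are unconstrained.  The data are the
  point \<open>x\<close> of \<open>space (\<mu> n)\<close>.

  \<^item> \<open>\<mu> n\<close> is the dominating measure and \<open>dens n \<theta>\<close> the density of the data under \<open>\<theta>\<close>, so
    \<open>dens n \<theta> x\<close> is also the likelihood of \<open>\<theta>\<close>;
  \<^item> \<open>\<Theta>\<close> is the full parameter space, as a topological space (the topology only serves to
    speak of the dimension of the models), and \<open>\<theta>s\<close> is the true parameter;
  \<^item> \<open>Mod n\<close> is the finite set of model indices, \<open>\<Theta>m n S\<close> the parameter set of model \<open>S\<close> and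
    \<open>dm S\<close> its dimension;
  \<^item> \<open>w n\<close> is the mass function on model indices, \<open>\<nu> n S\<close> the reference measure on
    \<open>\<Theta>m n S\<close>, and \<open>prd n S x\<close> the density of the data-dependent prior within model \<open>S\<close>;
  \<^item> \<open>mle n S x\<close> is the maximum likelihood estimate within model \<open>S\<close>.
\<close>

locale empirical_prior_setting =
  fixes \<mu> :: "nat \<Rightarrow> 'x measure"
    and dens :: "nat \<Rightarrow> 'a \<Rightarrow> 'x \<Rightarrow> real"
    and \<Theta> :: "'a topology"
    and \<theta>s :: 'a
    and Mod :: "nat \<Rightarrow> 's set"
    and \<Theta>m :: "nat \<Rightarrow> 's \<Rightarrow> 'a set"
    and dm :: "'s \<Rightarrow> nat"
    and w :: "nat \<Rightarrow> 's \<Rightarrow> real"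
    and \<nu> :: "nat \<Rightarrow> 's \<Rightarrow> 'a measure"
    and prd :: "nat \<Rightarrow> 's \<Rightarrow> 'x \<Rightarrow> 'a \<Rightarrow> real"
    and mle :: "nat \<Rightarrow> 's \<Rightarrow> 'x \<Rightarrow> 'a"
  assumes sigma_finite_\<mu>: "n \<ge> 1 \<Longrightarrow> sigma_finite_measure (\<mu> n)"
    and dens_measurable: "n \<ge> 1 \<Longrightarrow> \<theta> \<in> topspace \<Theta> \<Longrightarrow> dens n \<theta> \<in> borel_measurable (\<mu> n)"
    and dens_nonneg: "n \<ge> 1 \<Longrightarrow> \<theta> \<in> topspace \<Theta> \<Longrightarrow> x \<in> space (\<mu> n) \<Longrightarrow> dens n \<theta> x \<ge> 0"
    and dens_integral: "n \<ge> 1 \<Longrightarrow> \<theta> \<in> topspace \<Theta> \<Longrightarrow> (\<integral>\<^sup>+x. ennreal (dens n \<theta> x) \<partial>\<mu> n) = 1"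
    and true_parameter: "\<theta>s \<in> topspace \<Theta>"
    and finite_models: "n \<ge> 1 \<Longrightarrow> finite (Mod n)"
    and model_subset: "n \<ge> 1 \<Longrightarrow> S \<in> Mod n \<Longrightarrow> \<Theta>m n S \<subseteq> topspace \<Theta>"
    and model_dimension:
      "n \<ge> 1 \<Longrightarrow> S \<in> Mod n \<Longrightarrow> has_dimension (subtopology \<Theta> (\<Theta>m n S)) (dm S)"
    and w_nonneg: "n \<ge> 1 \<Longrightarrow> S \<in> Mod n \<Longrightarrow> w n S \<ge> 0"
    and w_sum: "n \<ge> 1 \<Longrightarrow> (\<Sum>S\<in>Mod n. w n S) = 1"
    and space_\<nu>: "n \<ge> 1 \<Longrightarrow> S \<in> Mod n \<Longrightarrow> space (\<nu> n S) = \<Theta>m n S"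
    and sigma_finite_\<nu>: "n \<ge> 1 \<Longrightarrow> S \<in> Mod n \<Longrightarrow> sigma_finite_measure (\<nu> n S)"
    and dens_joint_measurable:
      "n \<ge> 1 \<Longrightarrow> S \<in> Mod n \<Longrightarrow>
        (\<lambda>(\<theta>, x). dens n \<theta> x) \<in> borel_measurable (\<nu> n S \<Otimes>\<^sub>M \<mu> n)"
    and prd_joint_measurable:
      "n \<ge> 1 \<Longrightarrow> S \<in> Mod n \<Longrightarrow>
        (\<lambda>(\<theta>, x). prd n S x \<theta>) \<in> borel_measurable (\<nu> n S \<Otimes>\<^sub>M \<mu> n)"
    and prd_nonneg:
      "n \<ge> 1 \<Longrightarrow> S \<in> Mod n \<Longrightarrow> x \<in> space (\<mu> n) \<Longrightarrow> \<theta> \<in> \<Theta>m n S \<Longrightarrow> prd n S x \<theta> \<ge> 0"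
    and prd_integral:
      "n \<ge> 1 \<Longrightarrow> S \<in> Mod n \<Longrightarrow> x \<in> space (\<mu> n) \<Longrightarrow>
        (\<integral>\<^sup>+\<theta>. ennreal (prd n S x \<theta>) \<partial>\<nu> n S) = 1"
    and mle_in: "n \<ge> 1 \<Longrightarrow> S \<in> Mod n \<Longrightarrow> x \<in> space (\<mu> n) \<Longrightarrow> mle n S x \<in> \<Theta>m n S"
    and mle_max:
      "n \<ge> 1 \<Longrightarrow> S \<in> Mod n \<Longrightarrow> x \<in> space (\<mu> n) \<Longrightarrow> \<theta> \<in> \<Theta>m n S \<Longrightarrow>
        dens n \<theta> x \<le> dens n (mle n S x) x"
    and max_likelihood_measurable:
      "n \<ge> 1 \<Longrightarrow> S \<in> Mod n \<Longrightarrow> (\<lambda>x. dens n (mle n S x) x) \<in> borel_measurable (\<mu> n)"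

definition data_law :: "(nat \<Rightarrow> 'x measure) \<Rightarrow> (nat \<Rightarrow> 'a \<Rightarrow> 'x \<Rightarrow> real) \<Rightarrow> nat \<Rightarrow> 'a \<Rightarrow> 'x measure" where
  "data_law \<mu> dens n \<theta> = density (\<mu> n) (\<lambda>x. ennreal (dens n \<theta> x))"

definition model_prior ::
  "(nat \<Rightarrow> 's \<Rightarrow> 'a measure) \<Rightarrow> (nat \<Rightarrow> 's \<Rightarrow> 'x \<Rightarrow> 'a \<Rightarrow> real) \<Rightarrow> nat \<Rightarrow> 'x \<Rightarrow> 's \<Rightarrow> 'a measure" where
  "model_prior \<nu> prd n x S = density (\<nu> n S) (\<lambda>\<theta>. ennreal (prd n S x \<theta>))"

end

theory Submission
  imports Defs
begin

text \<open>
  Write \<open>R\<close> for the likelihood ratio.  Dividing the prior by the power \<open>1 - \<alpha>\<close> of the likelihood turns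
  the posterior into a quotient \<open>N / D\<close> in which \<open>N\<close> is at most the prior integral of \<open>R powr \<alpha>\<close>.
  By Hoelder's inequality, with \<open>\<beta> = 1 - 1 / p\<close>, the expectation of \<open>N\<close> splits into the \<open>p\<close>-th moments
  of the prior density and the expectations of \<open>R powr (\<alpha> / \<beta>)\<close>.  Since \<open>\<alpha> / \<beta> < 1\<close>, the latter are
  bounded by a power of the Hellinger affinity, hence are exponentially small away from the truth.
  The denominator is bounded below by restricting it to the near-maximizers in the model \<open>S\<^sup>\<dagger>\<close>, where
  \<open>R\<close> is at least of the order of \<open>R \<theta>\<^sup>\<dagger>\<close>, and Chebyshev's inequality bounds \<open>R \<theta>\<^sup>\<dagger>\<close> from below.
\<close>

section \<open>Hoelder's inequality and the Hellinger affinity\<close>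

text \<open>Weighted Young's inequality is applied pointwise to \<open>f x / a\<close> and
  \<open>g x / b\<close> and then integrated, which is Hoelder's inequality with exponents
  \<open>1 / s\<close> and \<open>1 / (1 - s)\<close>. The bounds \<open>a\<close> and
  \<open>b\<close> stand in for the two integrals, so that one-sided estimates can be inserted
  directly.\<close>

lemma nn_integral_powr_mult_le:
  fixes f g :: "'x \<Rightarrow> real"
  assumes [measurable]: "f \<in> borel_measurable M" "g \<in> borel_measurable M"
    and f0: "\<And>x. x \<in> space M \<Longrightarrow> 0 \<le> f x" and g0: "\<And>x. x \<in> space M \<Longrightarrow> 0 \<le> g x"
    and fa: "(\<integral>\<^sup>+x. ennreal (f x) \<partial>M) \<le> ennreal a" and gb: "(\<integral>\<^sup>+x. ennreal (g x) \<partial>M) \<le> ennreal b"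
    and ab: "0 \<le> a" "0 \<le> b" and s: "0 < s" "s < 1"
  shows "(\<integral>\<^sup>+x. ennreal (f x powr s * g x powr (1 - s)) \<partial>M) \<le> ennreal (a powr s * b powr (1 - s))"
\<comment> \<open>A zero bound rules out normalizing, but then one factor vanishes almost
  everywhere, and so does the product because \<open>0 powr s = 0\<close>.\<close>
proof (cases "a = 0 \<or> b = 0")
  case True
  then have "(\<integral>\<^sup>+x. ennreal (f x) \<partial>M) = 0 \<or> (\<integral>\<^sup>+x. ennreal (g x) \<partial>M) = 0"
    using fa gb by auto
  then have "(AE x in M. ennreal (f x) = 0) \<or> (AE x in M. ennreal (g x) = 0)"
    by (subst (asm) (1 2) nn_integral_0_iff_AE) simp_all
  then have "AE x in M. ennreal (f x powr s * g x powr (1 - s)) = 0"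
  proof
    assume "AE x in M. ennreal (f x) = 0"
    with AE_space show ?thesis
      by eventually_elim (use f0 in \<open>force simp: ennreal_eq_0_iff\<close>)
  next
    assume "AE x in M. ennreal (g x) = 0"
    with AE_space show ?thesis
      by eventually_elim (use g0 in \<open>force simp: ennreal_eq_0_iff\<close>)
  qed
  then have "(\<integral>\<^sup>+x. ennreal (f x powr s * g x powr (1 - s)) \<partial>M) = 0"
    by (subst nn_integral_0_iff_AE) simp_all
  then show ?thesis by simp
next
  case False
  with ab have ab: "0 < a" "0 < b" by auto
  \<comment> \<open>\<open>k\<close> is the target bound; multiplying by it undoes the division of
    \<open>f\<close> by \<open>a\<close> and of \<open>g\<close> by \<open>b\<close>.\<close>
  define k where "k = a powr s * b powr (1 - s)"
  have k: "0 < k" using ab by (simp add: k_def)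
  have "f x powr s * g x powr (1 - s) \<le> k * s / a * f x + k * (1 - s) / b * g x"
    if "x \<in> space M" for x
  proof -
    have "(f x / a) powr s * (g x / b) powr (1 - s) \<le> s * (f x / a) + (1 - s) * (g x / b)"
    proof (cases "f x = 0 \<or> g x = 0")
      case True
      with f0[OF that] g0[OF that] ab s show ?thesis by auto
    next
      case False
      with f0[OF that] g0[OF that] ab s show ?thesis by (intro Youngs_inequality_0) auto
    qed
    then have "k * ((f x / a) powr s * (g x / b) powr (1 - s)) \<le> k * (s * (f x / a) + (1 - s) * (g x / b))"
      using k by (intro mult_left_mono) auto
    moreover have "f x powr s * g x powr (1 - s) = k * ((f x / a) powr s * (g x / b) powr (1 - s))"
      using f0[OF that] g0[OF that] ab by (simp add: k_def powr_divide)
    ultimately show ?thesis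
      by (simp add: algebra_simps)
  qed
  then have "(\<integral>\<^sup>+x. ennreal (f x powr s * g x powr (1 - s)) \<partial>M) \<le>
      (\<integral>\<^sup>+x. ennreal (k * s / a) * ennreal (f x) + ennreal (k * (1 - s) / b) * ennreal (g x) \<partial>M)"
    using ab k s f0 g0
    by (intro nn_integral_mono) (simp flip: ennreal_mult ennreal_plus add: ennreal_leI)
  also have "\<dots> = ennreal (k * s / a) * (\<integral>\<^sup>+x. ennreal (f x) \<partial>M)
      + ennreal (k * (1 - s) / b) * (\<integral>\<^sup>+x. ennreal (g x) \<partial>M)"
    by (simp add: nn_integral_add nn_integral_cmult)
  also have "\<dots> \<le> ennreal (k * s / a) * ennreal a + ennreal (k * (1 - s) / b) * ennreal b"
    using fa gb by (intro add_mono mult_left_mono) auto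
  also have "\<dots> = ennreal k"
    using ab k s by (simp flip: ennreal_mult ennreal_plus) (simp add: algebra_simps)
  finally show ?thesis by (simp add: k_def)
qed

text \<open>Expanding the square under the integral gives
  \<open>f x + g x - 2 * sqrt (f x * g x)\<close>, whose first two terms integrate to 1 each. So one
  minus the squared Hellinger distance is the affinity, and the nonnegativity of the affinity gives
  the second claim.\<close>

lemma sqrt_mult_integral:
  fixes f g :: "'x \<Rightarrow> real"
  assumes [measurable]: "f \<in> borel_measurable M" "g \<in> borel_measurable M"
    and f0: "\<And>x. x \<in> space M \<Longrightarrow> 0 \<le> f x" and g0: "\<And>x. x \<in> space M \<Longrightarrow> 0 \<le> g x"
    and f1: "(\<integral>\<^sup>+x. ennreal (f x) \<partial>M) = 1" and g1: "(\<integral>\<^sup>+x. ennreal (g x) \<partial>M) = 1"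
  shows "(\<integral>\<^sup>+x. ennreal (sqrt (f x * g x)) \<partial>M) = ennreal (1 - hellinger_sq M f g)"
    and "hellinger_sq M f g \<le> 1"
proof -
  have f: "has_bochner_integral M f 1" and g: "has_bochner_integral M g 1"
    using f0 g0 f1 g1 by (auto intro!: has_bochner_integral_nn_integral)
  \<comment> \<open>The geometric mean is dominated by an integrable sum, so the Bochner integral
    may be split term by term below.\<close>
  have int: "integrable M (\<lambda>x. sqrt (f x * g x))"
  proof (rule Bochner_Integration.integrable_bound)
    show "integrable M (\<lambda>x. f x + g x)"
      using f g by (auto simp: has_bochner_integral_iff)
    show "AE x in M. norm (sqrt (f x * g x)) \<le> norm (f x + g x)"
    proof (rule AE_I2)
      fix x assume x: "x \<in> space M"
      have "sqrt (f x * g x) \<le> f x + g x"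
        using f0[OF x] g0[OF x] arith_geo_mean_sqrt[of "f x" "g x"] by auto
      with f0[OF x] g0[OF x] show "norm (sqrt (f x * g x)) \<le> norm (f x + g x)" by simp
    qed
  qed simp
  have "hellinger_sq M f g = 1 / 2 * (\<integral>x. f x + g x - 2 * sqrt (f x * g x) \<partial>M)"
    unfolding hellinger_sq_def using f0 g0
    by (intro arg_cong[where f="\<lambda>x. 1 / 2 * x"] Bochner_Integration.integral_cong)
      (auto simp: power2_diff real_sqrt_mult)
  also have "\<dots> = 1 - (\<integral>x. sqrt (f x * g x) \<partial>M)"
    using f g int by (simp add: has_bochner_integral_iff)
  finally have H: "hellinger_sq M f g = 1 - (\<integral>x. sqrt (f x * g x) \<partial>M)" .
  then show "(\<integral>\<^sup>+x. ennreal (sqrt (f x * g x)) \<partial>M) = ennreal (1 - hellinger_sq M f g)"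
    using int f0 g0 by (simp add: nn_integral_eq_integral)
  have "0 \<le> (\<integral>x. sqrt (f x * g x) \<partial>M)"
    using f0 g0 by (intro Bochner_Integration.integral_nonneg) auto
  with H show "hellinger_sq M f g \<le> 1" by simp
qed

lemma hellinger_sq_commute: "hellinger_sq M f g = hellinger_sq M g f"
  unfolding hellinger_sq_def by (simp add: power2_commute)

text \<open>Writing the integrand as the geometric mean to the power \<open>2 * a\<close> times
  \<open>g\<close> to the power \<open>1 - 2 * a\<close> lets Hoelder's inequality trade the
  fractional moment for the affinity. At \<open>a = 1 / 2\<close> the second exponent degenerates,
  but the integrand is then the geometric mean itself.\<close>

lemma nn_integral_powr_mult_le_hellinger_half:
  fixes f g :: "'x \<Rightarrow> real"
  assumes [measurable]: "f \<in> borel_measurable M" "g \<in> borel_measurable M"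
    and f0: "\<And>x. x \<in> space M \<Longrightarrow> 0 \<le> f x" and g0: "\<And>x. x \<in> space M \<Longrightarrow> 0 \<le> g x"
    and f1: "(\<integral>\<^sup>+x. ennreal (f x) \<partial>M) = 1" and g1: "(\<integral>\<^sup>+x. ennreal (g x) \<partial>M) = 1"
    and a: "0 < a" "a \<le> 1 / 2"
  shows "(\<integral>\<^sup>+x. ennreal (f x powr a * g x powr (1 - a)) \<partial>M)
    \<le> ennreal ((1 - hellinger_sq M f g) powr (2 * a))"
proof (cases "a = 1 / 2")
  case True
  have "(\<integral>\<^sup>+x. ennreal (f x powr a * g x powr (1 - a)) \<partial>M) = (\<integral>\<^sup>+x. ennreal (sqrt (f x * g x)) \<partial>M)"
    unfolding True using f0 g0 by (intro nn_integral_cong) (simp add: real_sqrt_mult powr_half_sqrt)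
  also have "\<dots> = ennreal ((1 - hellinger_sq M f g) powr (2 * a))"
    unfolding True using sqrt_mult_integral[OF assms(1-6)] by simp
  finally show ?thesis by simp
next
  case False
  have "f x powr a * g x powr (1 - a) = sqrt (f x * g x) powr (2 * a) * g x powr (1 - 2 * a)"
    if "x \<in> space M" for x
  proof (cases "f x = 0 \<or> g x = 0")
    case False
    with f0[OF that] g0[OF that] have pos: "0 < f x" "0 < g x" by auto
    then have "sqrt (f x * g x) powr (2 * a) = f x powr a * g x powr a"
      by (simp add: powr_powr powr_mult flip: powr_half_sqrt)
    with pos show ?thesis by (simp flip: powr_add)
  qed (use a in auto)
  then have "(\<integral>\<^sup>+x. ennreal (f x powr a * g x powr (1 - a)) \<partial>M)
    = (\<integral>\<^sup>+x. ennreal (sqrt (f x * g x) powr (2 * a) * g x powr (1 - 2 * a)) \<partial>M)"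
    by (intro nn_integral_cong) simp
  also have "\<dots> \<le> ennreal ((1 - hellinger_sq M f g) powr (2 * a) * 1 powr (1 - 2 * a))"
    using sqrt_mult_integral[OF assms(1-6)] a False f0 g0 g1
    by (intro nn_integral_powr_mult_le) auto
  finally show ?thesis by simp
qed

text \<open>For \<open>a > 1 / 2\<close> the roles of \<open>f\<close> and \<open>g\<close> are
  exchanged, the Hellinger distance being symmetric; hence the minimum in the exponent.\<close>

lemma nn_integral_powr_mult_le_hellinger:
  fixes f g :: "'x \<Rightarrow> real"
  assumes [measurable]: "f \<in> borel_measurable M" "g \<in> borel_measurable M"
    and f0: "\<And>x. x \<in> space M \<Longrightarrow> 0 \<le> f x" and g0: "\<And>x. x \<in> space M \<Longrightarrow> 0 \<le> g x"
    and f1: "(\<integral>\<^sup>+x. ennreal (f x) \<partial>M) = 1" and g1: "(\<integral>\<^sup>+x. ennreal (g x) \<partial>M) = 1"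
    and a: "0 < a" "a < 1"
  shows "(\<integral>\<^sup>+x. ennreal (f x powr a * g x powr (1 - a)) \<partial>M)
    \<le> ennreal ((1 - hellinger_sq M f g) powr (2 * min a (1 - a)))"
proof (cases "a \<le> 1 / 2")
  case True
  then have "min a (1 - a) = a" by simp
  then show ?thesis
    using nn_integral_powr_mult_le_hellinger_half[OF assms(1-6) a(1) True] by simp
next
  case False
  then have m: "min a (1 - a) = 1 - a" by simp
  have "(\<integral>\<^sup>+x. ennreal (g x powr (1 - a) * f x powr (1 - (1 - a))) \<partial>M)
    \<le> ennreal ((1 - hellinger_sq M g f) powr (2 * (1 - a)))"
    using False a by (intro nn_integral_powr_mult_le_hellinger_half assms) auto
  then show ?thesis by (simp add: m mult.commute hellinger_sq_commute)
qed

text \<open>The bound is Chebyshev's inequality for the uncentred log-likelihood ratio.\<close>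

lemma small_likelihood_ratio_le:
  fixes f g :: "'x \<Rightarrow> real"
  assumes [measurable]: "f \<in> borel_measurable M" "g \<in> borel_measurable M"
    and f0: "\<And>x. x \<in> space M \<Longrightarrow> 0 \<le> f x" and g0: "\<And>x. x \<in> space M \<Longrightarrow> 0 \<le> g x"
    and V: "KL_var M f g \<le> ennreal v" and t: "0 < t" and v: "0 \<le> v"
  shows "emeasure (density M (\<lambda>x. ennreal (f x))) {x \<in> space M. g x < exp (- t) * f x} \<le> ennreal (v / t\<^sup>2)"
proof -
  let ?B = "{x \<in> space M. g x < exp (- t) * f x}"
  \<comment> \<open>On \<open>?B\<close> the log-likelihood ratio is at least \<open>t\<close>, and
    off \<open>?B\<close> the left side is 0. Integrating this is Markov's inequality for the
    squared log-ratio.\<close>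
  have le: "ennreal (t\<^sup>2) * (ennreal (f x) * indicator ?B x)
      \<le> (e2ennreal \<bar>log_ratio (f x) (g x)\<bar>)\<^sup>2 * ennreal (f x)" if x: "x \<in> space M" for x
  proof (cases "x \<in> ?B")
    case True
    with g0[OF x] have fx: "0 < f x"
      by (smt (verit) exp_gt_zero mem_Collect_eq zero_less_mult_iff)
    have "ennreal t \<le> e2ennreal \<bar>log_ratio (f x) (g x)\<bar>"
    \<comment> \<open>A vanishing \<open>g x\<close> makes the log-ratio infinite, so the bound is
      trivial there.\<close>
    proof (cases "g x = 0")
      case True
      with fx show ?thesis by (simp add: log_ratio_def)
    next
      case False
      with g0[OF x] have gx: "0 < g x" by simp
      have "ln (g x) < ln (exp (- t) * f x)"
        using True gx fx by (subst ln_less_cancel_iff) auto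
      then have "t \<le> ln (f x / g x)"
        using fx gx by (simp add: ln_mult ln_div)
      with fx gx t show ?thesis
        by (simp add: log_ratio_def ennreal_leI)
    qed
    then have "(ennreal t)\<^sup>2 \<le> (e2ennreal \<bar>log_ratio (f x) (g x)\<bar>)\<^sup>2"
      by (intro power_mono) auto
    with True t show ?thesis
      by (auto simp: ennreal_power intro!: mult_right_mono)
  qed simp
  have "ennreal (t\<^sup>2) * emeasure (density M (\<lambda>x. ennreal (f x))) ?B
      = (\<integral>\<^sup>+x. ennreal (t\<^sup>2) * (ennreal (f x) * indicator ?B x) \<partial>M)"
    by (simp add: emeasure_density nn_integral_cmult)
  also have "\<dots> \<le> KL_var M f g"
    unfolding KL_var_def by (intro nn_integral_mono le)
  also note V
  finally have "ennreal (t\<^sup>2) * emeasure (density M (\<lambda>x. ennreal (f x))) ?B \<le> ennreal v" .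
  then have "ennreal (1 / t\<^sup>2) * (ennreal (t\<^sup>2) * emeasure (density M (\<lambda>x. ennreal (f x))) ?B)
      \<le> ennreal (1 / t\<^sup>2) * ennreal v"
    by (rule mult_left_mono) simp
  then show ?thesis
    using t v by (simp add: mult.assoc[symmetric] flip: ennreal_mult)
qed

section \<open>Mixture measures and double empirical priors\<close>

context
  fixes I :: "'s set" and wt :: "'s \<Rightarrow> ennreal" and Q :: "'s \<Rightarrow> 'a measure"
begin

abbreviation (input) "mix_sets \<equiv>
  {A. A \<subseteq> (\<Union>S\<in>I. space (Q S)) \<and> (\<forall>S\<in>I. A \<inter> space (Q S) \<in> sets (Q S))}"

text \<open>Intersecting with a fixed \<open>space (Q S)\<close> commutes with relative complements
  and countable unions, so every trace condition is preserved, also when the spaces overlap.\<close>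

lemma sigma_algebra_mixture: "sigma_algebra (\<Union>S\<in>I. space (Q S)) mix_sets"
  unfolding sigma_algebra_iff2
proof (intro conjI ballI allI impI)
  fix A assume "A \<in> mix_sets"
  moreover have "((\<Union>S\<in>I. space (Q S)) - A) \<inter> space (Q S) = space (Q S) - A \<inter> space (Q S)"
    if "S \<in> I" for S using that by auto
  ultimately show "(\<Union>S\<in>I. space (Q S)) - A \<in> mix_sets" by auto
next
  fix A :: "nat \<Rightarrow> 'a set" assume A: "range A \<subseteq> mix_sets"
  have "(\<Union>i. A i) \<inter> space (Q S) = (\<Union>i. A i \<inter> space (Q S))" for S by auto
  moreover have "(\<Union>i. A i \<inter> space (Q S)) \<in> sets (Q S)" if "S \<in> I" for S
    using A that by (intro sets.countable_UN) auto
  ultimately show "(\<Union>i. A i) \<in> mix_sets" using A by auto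
qed auto

lemma space_mixture_measure: "space (mixture_measure I wt Q) = (\<Union>S\<in>I. space (Q S))"
  and sets_mixture_measure: "sets (mixture_measure I wt Q) = mix_sets"
  using sigma_algebra.space_measure_of_eq[OF sigma_algebra_mixture]
    sigma_algebra.sets_measure_of_eq[OF sigma_algebra_mixture]
  unfolding mixture_measure_def by auto

text \<open>\<open>measure_of\<close> is guaranteed to take the prescribed values once the set
  function is countably additive. Additivity passes from each \<open>Q S\<close> to the weighted sum
  because disjoint sets have disjoint traces.\<close>

lemma emeasure_mixture_measure:
  assumes "A \<in> mix_sets"
  shows "emeasure (mixture_measure I wt Q) A = (\<Sum>S\<in>I. wt S * emeasure (Q S) (A \<inter> space (Q S)))"
  unfolding mixture_measure_def
proof (rule emeasure_measure_of_sigma[OF sigma_algebra_mixture _ _ assms])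
  show "countably_additive mix_sets (\<lambda>A. \<Sum>S\<in>I. wt S * emeasure (Q S) (A \<inter> space (Q S)))"
  proof (rule countably_additiveI)
    fix A :: "nat \<Rightarrow> 'a set"
    assume A: "range A \<subseteq> mix_sets" and dA: "disjoint_family A"
    have "(\<Sum>i. \<Sum>S\<in>I. wt S * emeasure (Q S) (A i \<inter> space (Q S)))
        = (\<Sum>S\<in>I. wt S * (\<Sum>i. emeasure (Q S) (A i \<inter> space (Q S))))"
      by (subst suminf_sum) auto
    also have "\<dots> = (\<Sum>S\<in>I. wt S * emeasure (Q S) ((\<Union>i. A i) \<inter> space (Q S)))"
    proof (intro sum.cong refl arg_cong2[where f="(*)"])
      fix S assume S: "S \<in> I"
      have "(\<Sum>i. emeasure (Q S) (A i \<inter> space (Q S))) = emeasure (Q S) (\<Union>i. A i \<inter> space (Q S))"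
        using A S dA by (intro suminf_emeasure) (auto simp: disjoint_family_on_def, blast)
      then show "(\<Sum>i. emeasure (Q S) (A i \<inter> space (Q S))) = emeasure (Q S) ((\<Union>i. A i) \<inter> space (Q S))"
        by simp
    qed
    finally show "(\<Sum>i. \<Sum>S\<in>I. wt S * emeasure (Q S) (A i \<inter> space (Q S)))
        = (\<Sum>S\<in>I. wt S * emeasure (Q S) ((\<Union>i. A i) \<inter> space (Q S)))" .
  qed
qed (simp add: positive_def)

lemma measurable_mixture_measure:
  assumes "\<And>S. S \<in> I \<Longrightarrow> h \<in> measurable (Q S) N"
  shows "h \<in> measurable (mixture_measure I wt Q) N"
proof (rule measurableI)
  fix A assume "A \<in> sets N"
  have "h -` A \<inter> (\<Union>S\<in>I. space (Q S)) \<inter> space (Q S) = h -` A \<inter> space (Q S)" if "S \<in> I" for S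
    using that by auto
  then show "h -` A \<inter> space (mixture_measure I wt Q) \<in> sets (mixture_measure I wt Q)"
    using \<open>A \<in> sets N\<close> assms by (auto simp: space_mixture_measure sets_mixture_measure)
qed (use assms in \<open>auto simp: space_mixture_measure dest: measurable_space\<close>)

text \<open>Converse of \<open>measurable_mixture_measure\<close>. In the induction of the next
  lemma the approximating functions are measurable for the mixture and have to be integrated against
  each \<open>Q S\<close>.\<close>

lemma measurable_from_mixture_measure:
  assumes "h \<in> measurable (mixture_measure I wt Q) N" "S \<in> I"
  shows "h \<in> measurable (Q S) N"
proof (rule measurableI)
  fix A assume "A \<in> sets N"
  then have "h -` A \<inter> (\<Union>S\<in>I. space (Q S)) \<inter> space (Q S) \<in> sets (Q S)"
    using measurable_sets[OF assms(1), of A] assms(2)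
    by (auto simp: space_mixture_measure sets_mixture_measure)
  moreover have "h -` A \<inter> (\<Union>S\<in>I. space (Q S)) \<inter> space (Q S) = h -` A \<inter> space (Q S)"
    using assms(2) by auto
  ultimately show "h -` A \<inter> space (Q S) \<in> sets (Q S)" by simp
qed (use assms measurable_space[OF assms(1)] in \<open>auto simp: space_mixture_measure\<close>)

text \<open>Indicators are covered by \<open>emeasure_mixture_measure\<close>. Both sides respect
  sums, scaling and increasing limits, so induction on nonnegative measurable functions extends the
  identity.\<close>

lemma nn_integral_mixture_measure:
  assumes h: "\<And>S. S \<in> I \<Longrightarrow> h \<in> borel_measurable (Q S)"
  shows "(\<integral>\<^sup>+\<theta>. h \<theta> \<partial>mixture_measure I wt Q) = (\<Sum>S\<in>I. wt S * (\<integral>\<^sup>+\<theta>. h \<theta> \<partial>Q S))"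
proof -
  have "h \<in> borel_measurable (mixture_measure I wt Q)"
    using h by (rule measurable_mixture_measure)
  then show ?thesis
  proof (induction rule: borel_measurable_induct)
    case (cong f g)
    have "(\<integral>\<^sup>+\<theta>. f \<theta> \<partial>Q S) = (\<integral>\<^sup>+\<theta>. g \<theta> \<partial>Q S)" if "S \<in> I" for S
      using cong(3) that by (intro nn_integral_cong) (auto simp: space_mixture_measure)
    with cong show ?case by (simp cong: nn_integral_cong)
  next
    case (set A)
    have "(\<integral>\<^sup>+\<theta>. indicator A \<theta> \<partial>Q S) = emeasure (Q S) (A \<inter> space (Q S))" if "S \<in> I" for S
    proof -
      have "(\<integral>\<^sup>+\<theta>. indicator A \<theta> \<partial>Q S) = (\<integral>\<^sup>+\<theta>. indicator (A \<inter> space (Q S)) \<theta> \<partial>Q S)"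
        by (intro nn_integral_cong) (simp split: split_indicator)
      also have "\<dots> = emeasure (Q S) (A \<inter> space (Q S))"
        using set that by (intro nn_integral_indicator) (auto simp: sets_mixture_measure)
      finally show ?thesis .
    qed
    moreover have "A \<in> mix_sets" using set by (simp add: sets_mixture_measure)
    ultimately show ?case using set by (simp add: emeasure_mixture_measure)
  next
    case (mult u c)
    then show ?case
      using measurable_from_mixture_measure[OF mult(2)]
      by (simp add: nn_integral_cmult sum_distrib_left mult.left_commute)
  next
    case (add u v)
    then show ?case
      using measurable_from_mixture_measure[OF add(1)] measurable_from_mixture_measure[OF add(3)]
      by (simp add: nn_integral_add distrib_left sum.distrib)
  next
    case (seq U)
    have U: "U i \<in> borel_measurable (Q S)" if "S \<in> I" for i S
      using measurable_from_mixture_measure[OF seq(1) that] .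
    have inc: "incseq (\<lambda>i. \<integral>\<^sup>+\<theta>. U i \<theta> \<partial>Q S)" for S
      using seq(3) by (auto simp: incseq_def le_fun_def intro!: nn_integral_mono)
    have "(\<integral>\<^sup>+\<theta>. (SUP i. U i) \<theta> \<partial>mixture_measure I wt Q) = (SUP i. \<integral>\<^sup>+\<theta>. U i \<theta> \<partial>mixture_measure I wt Q)"
      unfolding SUP_apply by (rule nn_integral_monotone_convergence_SUP) (use seq in auto)
    also have "\<dots> = (SUP i. \<Sum>S\<in>I. wt S * (\<integral>\<^sup>+\<theta>. U i \<theta> \<partial>Q S))"
      using seq by simp
    \<comment> \<open>The supremum passes through the sum because every summand increases with
      \<open>i\<close>.\<close>
    also have "\<dots> = (\<Sum>S\<in>I. SUP i. wt S * (\<integral>\<^sup>+\<theta>. U i \<theta> \<partial>Q S))"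
      using inc by (intro ennreal_SUP_sum) (auto simp: incseq_def intro: mult_left_mono)
    also have "\<dots> = (\<Sum>S\<in>I. wt S * (\<integral>\<^sup>+\<theta>. (SUP i. U i) \<theta> \<partial>Q S))"
      unfolding SUP_apply using U seq(3)
      by (intro sum.cong refl) (simp add: SUP_mult_left_ennreal nn_integral_monotone_convergence_SUP)
    finally show ?case .
  qed
qed

end

section \<open>Bounds on the posterior for a fixed sample\<close>

text \<open>In the degenerate cases the conventions of \<open>ennreal\<close> decide: a zero
  denominator forces a zero numerator and \<open>0 / 0 = 0\<close>, and division by infinity gives
  0. This is the crude bound used on exceptional samples.\<close>

lemma posterior_le_1:
  assumes [measurable]: "R \<in> borel_measurable P"
  shows "posterior P R A \<le> 1"
proof -
  have le: "(\<integral>\<^sup>+\<theta>\<in>A. ennreal (R \<theta>) \<partial>P) \<le> (\<integral>\<^sup>+\<theta>. ennreal (R \<theta>) \<partial>P)"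
    by (intro nn_integral_mono) (simp split: split_indicator)
  show ?thesis
    unfolding posterior_def
    using le by (cases "(\<integral>\<^sup>+\<theta>. ennreal (R \<theta>) \<partial>P) = 0 \<or> (\<integral>\<^sup>+\<theta>. ennreal (R \<theta>) \<partial>P) = \<top>")
      (auto intro: divide_le_posI_ennreal simp: zero_less_iff_neq_zero)
qed

text \<open>
  Both regularizations give the same kind of posterior numerator: up to a constant \<open>k\<close>, the prior
  \<open>Q S\<close> is weighted by a \<open>W S\<close> that never exceeds the \<open>\<alpha>\<close>-th power of the likelihood ratio and is
  comparable to its maximum wherever the likelihood is nearly maximal.
\<close>

lemma double_prior_integral:
  fixes L :: "'a \<Rightarrow> real"
  assumes P: "type1_prior \<alpha> I w Q L P \<or> type2_prior \<alpha> I w Q Lmax P"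
    and L: "\<And>S. S \<in> I \<Longrightarrow> L \<in> borel_measurable (Q S)"
    and L0: "\<And>S \<theta>. S \<in> I \<Longrightarrow> \<theta> \<in> space (Q S) \<Longrightarrow> 0 \<le> L \<theta>"
    and Lmax: "\<And>S \<theta>. S \<in> I \<Longrightarrow> \<theta> \<in> space (Q S) \<Longrightarrow> L \<theta> \<le> Lmax S"
    and Ls: "0 < Ls" and \<alpha>: "0 < \<alpha>" "\<alpha> < 1" and w0: "\<And>S. S \<in> I \<Longrightarrow> 0 \<le> w S"
  obtains k W where "0 < k" "k < \<top>"
    "\<And>S. S \<in> I \<Longrightarrow> W S \<in> borel_measurable (Q S)"
    "\<And>S \<theta>. S \<in> I \<Longrightarrow> \<theta> \<in> space (Q S) \<Longrightarrow> W S \<theta> \<le> ennreal ((L \<theta> / Ls) powr \<alpha>)"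
    "\<And>S \<theta> r. S \<in> I \<Longrightarrow> \<theta> \<in> space (Q S) \<Longrightarrow> 0 < r \<Longrightarrow> r \<le> 1 \<Longrightarrow> r * Lmax S \<le> L \<theta> \<Longrightarrow>
       ennreal (r * (Lmax S / Ls) powr \<alpha>) \<le> W S \<theta>"
    "\<And>g. \<forall>S\<in>I. g \<in> borel_measurable (Q S) \<Longrightarrow>
       (\<integral>\<^sup>+\<theta>. ennreal (L \<theta> / Ls) * g \<theta> \<partial>P) = k * (\<Sum>S\<in>I. ennreal (w S) * (\<integral>\<^sup>+\<theta>. W S \<theta> * g \<theta> \<partial>Q S))"
proof -
  from P show thesis
  proof
    assume "type1_prior \<alpha> I w Q L P"
    then obtain c where c: "0 < c" "c < \<top>" and P: "P = scale_measure c
          (density (mixture_measure I (\<lambda>S. ennreal (w S)) Q) (\<lambda>\<theta>. 1 / ennreal (L \<theta> powr (1 - \<alpha>))))"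
      unfolding type1_prior_def by blast
    \<comment> \<open>Type 1: dividing the likelihood by its power \<open>1 - \<alpha>\<close>
      leaves exactly the power \<open>\<alpha>\<close>; the surplus power of \<open>Ls\<close> moves
      into \<open>?k\<close>.\<close>
    let ?W = "\<lambda>S \<theta>. ennreal ((L \<theta> / Ls) powr \<alpha>)"
    let ?k = "c * ennreal (Ls powr (\<alpha> - 1))"
    show thesis
    proof (rule that[of ?k ?W])
      show "0 < ?k" "?k < \<top>"
        using c Ls by (auto simp: ennreal_zero_less_mult_iff ennreal_mult_less_top)
    next
      fix S assume "S \<in> I" then show "?W S \<in> borel_measurable (Q S)"
        using L by measurable
    next
      fix S \<theta> r assume S: "S \<in> I" "\<theta> \<in> space (Q S)" and r: "0 < r" "r \<le> (1::real)" "r * Lmax S \<le> L \<theta>"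
      have M0: "0 \<le> Lmax S" using L0[OF S] Lmax[OF S] by simp
      \<comment> \<open>Passing from \<open>r powr \<alpha>\<close> to the smaller \<open>r\<close>
        gives a form that Type 2 satisfies as well, where the weight is linear in the
        likelihood.\<close>
      have "r powr 1 \<le> r powr \<alpha>" using r \<alpha> by (intro powr_mono') auto
      then have "r * (Lmax S / Ls) powr \<alpha> \<le> r powr \<alpha> * (Lmax S / Ls) powr \<alpha>"
        using r by (intro mult_right_mono) auto
      also have "\<dots> = (r * Lmax S / Ls) powr \<alpha>" using r M0 Ls by (simp add: powr_mult powr_divide)
      also have "\<dots> \<le> (L \<theta> / Ls) powr \<alpha>"
        using r M0 Ls \<alpha> by (intro powr_mono2 divide_right_mono) auto
      finally show "ennreal (r * (Lmax S / Ls) powr \<alpha>) \<le> ?W S \<theta>" by (rule ennreal_leI)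
    next
      fix g :: "'a \<Rightarrow> ennreal" assume "\<forall>S\<in>I. g \<in> borel_measurable (Q S)"
      then have g: "\<And>S. S \<in> I \<Longrightarrow> g \<in> borel_measurable (Q S)" by blast
      let ?M = "mixture_measure I (\<lambda>S. ennreal (w S)) Q"
      have [measurable]: "L \<in> borel_measurable ?M" "g \<in> borel_measurable ?M"
        using L g by (auto intro: measurable_mixture_measure)
      have "(\<integral>\<^sup>+\<theta>. ennreal (L \<theta> / Ls) * g \<theta> \<partial>P)
          = c * (\<integral>\<^sup>+\<theta>. 1 / ennreal (L \<theta> powr (1 - \<alpha>)) * (ennreal (L \<theta> / Ls) * g \<theta>) \<partial>?M)"
        unfolding P by (simp add: nn_integral_scale_measure nn_integral_density)
      also have "(\<integral>\<^sup>+\<theta>. 1 / ennreal (L \<theta> powr (1 - \<alpha>)) * (ennreal (L \<theta> / Ls) * g \<theta>) \<partial>?M)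
          = (\<integral>\<^sup>+\<theta>. ennreal (Ls powr (\<alpha> - 1)) * (ennreal ((L \<theta> / Ls) powr \<alpha>) * g \<theta>) \<partial>?M)"
      proof (intro nn_integral_cong)
        fix \<theta> assume "\<theta> \<in> space ?M"
        with L0 have "0 \<le> L \<theta>" by (auto simp: space_mixture_measure)
        have "1 / ennreal (L \<theta> powr (1 - \<alpha>)) * ennreal (L \<theta> / Ls)
            = ennreal (Ls powr (\<alpha> - 1)) * ennreal ((L \<theta> / Ls) powr \<alpha>)"
        \<comment> \<open>Where the likelihood vanishes the prior density is infinite, but it
          multiplies a zero likelihood ratio, and \<open>0 * \<infinity> = 0\<close> matches
          \<open>0 powr \<alpha> = 0\<close>.\<close>
        proof (cases "L \<theta> = 0")
          case False
          with \<open>0 \<le> L \<theta>\<close> have "0 < L \<theta>" by simp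
          then have "1 / L \<theta> powr (1 - \<alpha>) * (L \<theta> / Ls) = Ls powr (\<alpha> - 1) * (L \<theta> / Ls) powr \<alpha>"
            using Ls by (simp add: powr_divide powr_diff field_simps)
          moreover have "1 / ennreal (L \<theta> powr (1 - \<alpha>)) = ennreal (1 / L \<theta> powr (1 - \<alpha>))"
            using \<open>0 < L \<theta>\<close> by (simp add: divide_ennreal flip: ennreal_1)
          ultimately show ?thesis
            using \<open>0 < L \<theta>\<close> Ls by (simp flip: ennreal_mult)
        qed (use \<alpha> in simp)
        then show "1 / ennreal (L \<theta> powr (1 - \<alpha>)) * (ennreal (L \<theta> / Ls) * g \<theta>)
            = ennreal (Ls powr (\<alpha> - 1)) * (ennreal ((L \<theta> / Ls) powr \<alpha>) * g \<theta>)"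
          by (simp add: mult.assoc[symmetric])
      qed
      also have "\<dots> = ennreal (Ls powr (\<alpha> - 1)) * (\<integral>\<^sup>+\<theta>. ennreal ((L \<theta> / Ls) powr \<alpha>) * g \<theta> \<partial>?M)"
        by (rule nn_integral_cmult) measurable
      also have "(\<integral>\<^sup>+\<theta>. ennreal ((L \<theta> / Ls) powr \<alpha>) * g \<theta> \<partial>?M)
          = (\<Sum>S\<in>I. ennreal (w S) * (\<integral>\<^sup>+\<theta>. ?W S \<theta> * g \<theta> \<partial>Q S))"
      proof (rule nn_integral_mixture_measure)
        fix S assume "S \<in> I"
        note [measurable] = L[OF this] g[OF this]
        show "(\<lambda>\<theta>. ennreal ((L \<theta> / Ls) powr \<alpha>) * g \<theta>) \<in> borel_measurable (Q S)" by measurable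
      qed
      finally show "(\<integral>\<^sup>+\<theta>. ennreal (L \<theta> / Ls) * g \<theta> \<partial>P)
          = ?k * (\<Sum>S\<in>I. ennreal (w S) * (\<integral>\<^sup>+\<theta>. ?W S \<theta> * g \<theta> \<partial>Q S))"
        by (simp add: mult.assoc)
    qed simp
  next
    assume "type2_prior \<alpha> I w Q Lmax P"
    then obtain c wt where c: "0 < c" "c < \<top>"
      and wt: "\<And>S. S \<in> I \<Longrightarrow> wt S = c * (ennreal (w S) / ennreal (Lmax S powr (1 - \<alpha>)))"
      and P: "P = mixture_measure I wt Q"
      unfolding type2_prior_def by blast
    \<comment> \<open>Type 2: the normalizer is the maximum over the model, so the weight equals the
      \<open>\<alpha>\<close>-th power of the ratio at a maximizer and does not exceed it
      elsewhere.\<close>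
    let ?W = "\<lambda>S \<theta>. ennreal (L \<theta> / (Lmax S powr (1 - \<alpha>) * Ls powr \<alpha>))"
    let ?k = "c * ennreal (Ls powr (\<alpha> - 1))"
    show thesis
    proof (rule that[of ?k ?W])
      show "0 < ?k" "?k < \<top>"
        using c Ls by (auto simp: ennreal_zero_less_mult_iff ennreal_mult_less_top)
    next
      fix S assume "S \<in> I" then show "?W S \<in> borel_measurable (Q S)"
        using L by measurable
    next
      fix S \<theta> assume S: "S \<in> I" "\<theta> \<in> space (Q S)"
      note L0 = L0[OF S] and Lmax = Lmax[OF S]
      show "?W S \<theta> \<le> ennreal ((L \<theta> / Ls) powr \<alpha>)"
      proof (cases "L \<theta> = 0")
        case False
        with L0 have pos: "0 < L \<theta>" "0 < Lmax S" using Lmax by auto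
        \<comment> \<open>Since \<open>1 - \<alpha>\<close> is positive, replacing
          \<open>Lmax S\<close> by the smaller \<open>L \<theta>\<close> in the denominator can only
          increase the quotient.\<close>
        have "L \<theta> / (Lmax S powr (1 - \<alpha>) * Ls powr \<alpha>) \<le> L \<theta> / (L \<theta> powr (1 - \<alpha>) * Ls powr \<alpha>)"
          using pos Lmax Ls \<alpha> by (intro divide_left_mono mult_right_mono powr_mono2 mult_pos_pos) auto
        also have "\<dots> = (L \<theta> / Ls) powr \<alpha>"
          using pos Ls by (simp add: powr_divide powr_diff field_simps)
        finally show ?thesis by (rule ennreal_leI)
      qed simp
    next
      fix S \<theta> r assume S: "S \<in> I" "\<theta> \<in> space (Q S)" and r: "0 < r" "r \<le> (1::real)" "r * Lmax S \<le> L \<theta>"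
      note L0 = L0[OF S] and Lmax = Lmax[OF S]
      show "ennreal (r * (Lmax S / Ls) powr \<alpha>) \<le> ?W S \<theta>"
      proof (cases "Lmax S = 0")
        case False
        with L0 Lmax have pos: "0 < Lmax S" by auto
        have "r * (Lmax S / Ls) powr \<alpha> = r * Lmax S / (Lmax S powr (1 - \<alpha>) * Ls powr \<alpha>)"
          using pos Ls by (simp add: powr_divide powr_diff field_simps)
        also have "\<dots> \<le> L \<theta> / (Lmax S powr (1 - \<alpha>) * Ls powr \<alpha>)"
          using r by (intro divide_right_mono) auto
        finally show ?thesis by (rule ennreal_leI)
      qed simp
    next
      fix g :: "'a \<Rightarrow> ennreal" assume "\<forall>S\<in>I. g \<in> borel_measurable (Q S)"
      then have g: "\<And>S. S \<in> I \<Longrightarrow> g \<in> borel_measurable (Q S)" by blast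
      have "(\<integral>\<^sup>+\<theta>. ennreal (L \<theta> / Ls) * g \<theta> \<partial>P)
          = (\<Sum>S\<in>I. wt S * (\<integral>\<^sup>+\<theta>. ennreal (L \<theta> / Ls) * g \<theta> \<partial>Q S))"
        unfolding P
      proof (rule nn_integral_mixture_measure)
        fix S assume "S \<in> I"
        note [measurable] = L[OF this] g[OF this]
        show "(\<lambda>\<theta>. ennreal (L \<theta> / Ls) * g \<theta>) \<in> borel_measurable (Q S)" by measurable
      qed
      also have "\<dots> = (\<Sum>S\<in>I. ?k * (ennreal (w S) * (\<integral>\<^sup>+\<theta>. ?W S \<theta> * g \<theta> \<partial>Q S)))"
      proof (intro sum.cong refl)
        fix S assume S: "S \<in> I"
        note [measurable] = L[OF S] g[OF S]
        show "wt S * (\<integral>\<^sup>+\<theta>. ennreal (L \<theta> / Ls) * g \<theta> \<partial>Q S)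
          = ?k * (ennreal (w S) * (\<integral>\<^sup>+\<theta>. ?W S \<theta> * g \<theta> \<partial>Q S))"
        \<comment> \<open>A model whose maximal likelihood is 0 may receive infinite weight. This is
          harmless, as the likelihood ratio then vanishes on the whole model.\<close>
        proof (cases "Lmax S \<le> 0")
          case True
          have Lz: "L \<theta> = 0" if "\<theta> \<in> space (Q S)" for \<theta>
            using L0[OF S that] Lmax[OF S that] True by simp
          then have "(\<integral>\<^sup>+\<theta>. ennreal (L \<theta> / Ls) * g \<theta> \<partial>Q S) = (\<integral>\<^sup>+\<theta>. 0 \<partial>Q S)"
            "(\<integral>\<^sup>+\<theta>. ?W S \<theta> * g \<theta> \<partial>Q S) = (\<integral>\<^sup>+\<theta>. 0 \<partial>Q S)"
            by (auto intro!: nn_integral_cong simp del: nn_integral_const)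
          then show ?thesis by simp
        next
          case False
          then have pos: "0 < Lmax S" by simp
          have "ennreal (1 / Lmax S powr (1 - \<alpha>)) * (\<integral>\<^sup>+\<theta>. ennreal (L \<theta> / Ls) * g \<theta> \<partial>Q S)
              = (\<integral>\<^sup>+\<theta>. ennreal (1 / Lmax S powr (1 - \<alpha>)) * (ennreal (L \<theta> / Ls) * g \<theta>) \<partial>Q S)"
            by (simp add: nn_integral_cmult)
          also have "\<dots> = (\<integral>\<^sup>+\<theta>. ennreal (Ls powr (\<alpha> - 1)) * (?W S \<theta> * g \<theta>) \<partial>Q S)"
          proof (intro nn_integral_cong)
            fix \<theta> assume "\<theta> \<in> space (Q S)"
            then have "0 \<le> L \<theta>" using L0[OF S] by simp
            then have "ennreal (1 / Lmax S powr (1 - \<alpha>)) * ennreal (L \<theta> / Ls) = ennreal (Ls powr (\<alpha> - 1)) * ?W S \<theta>"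
              using pos Ls by (simp add: powr_diff field_simps flip: ennreal_mult)
            then show "ennreal (1 / Lmax S powr (1 - \<alpha>)) * (ennreal (L \<theta> / Ls) * g \<theta>)
                = ennreal (Ls powr (\<alpha> - 1)) * (?W S \<theta> * g \<theta>)"
              by (simp add: mult.assoc[symmetric])
          qed
          also have "\<dots> = ennreal (Ls powr (\<alpha> - 1)) * (\<integral>\<^sup>+\<theta>. ?W S \<theta> * g \<theta> \<partial>Q S)"
            by (rule nn_integral_cmult) measurable
          finally have *: "ennreal (1 / Lmax S powr (1 - \<alpha>)) * (\<integral>\<^sup>+\<theta>. ennreal (L \<theta> / Ls) * g \<theta> \<partial>Q S)
              = ennreal (Ls powr (\<alpha> - 1)) * (\<integral>\<^sup>+\<theta>. ?W S \<theta> * g \<theta> \<partial>Q S)" .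
          have "wt S = c * ennreal (w S) * ennreal (1 / Lmax S powr (1 - \<alpha>))"
            using pos w0[OF S] by (simp add: wt[OF S] divide_ennreal mult.assoc flip: ennreal_mult)
          then have "wt S * (\<integral>\<^sup>+\<theta>. ennreal (L \<theta> / Ls) * g \<theta> \<partial>Q S) = c * ennreal (w S) *
              (ennreal (1 / Lmax S powr (1 - \<alpha>)) * (\<integral>\<^sup>+\<theta>. ennreal (L \<theta> / Ls) * g \<theta> \<partial>Q S))"
            by (simp add: mult.assoc)
          then show ?thesis unfolding * by (simp add: mult_ac)
        qed
      qed
      finally show "(\<integral>\<^sup>+\<theta>. ennreal (L \<theta> / Ls) * g \<theta> \<partial>P)
          = ?k * (\<Sum>S\<in>I. ennreal (w S) * (\<integral>\<^sup>+\<theta>. ?W S \<theta> * g \<theta> \<partial>Q S))"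
        by (simp add: sum_distrib_left)
    qed
  qed
qed

text \<open>The unknown normalizing constant occurs in numerator and denominator and cancels. The
  denominator keeps only the near-maximizers in the model \<open>S\<^sub>0\<close>: from below,
  \<open>v\<close> bounds the model weight, \<open>m\<close> their prior mass and
  \<open>r * s powr \<alpha>\<close> the regularized likelihood ratio.\<close>

lemma posterior_le:
  fixes L :: "'a \<Rightarrow> real"
  assumes P: "type1_prior \<alpha> I w Q L P \<or> type2_prior \<alpha> I w Q Lmax P"
    and I: "finite I"
    and L: "\<And>S. S \<in> I \<Longrightarrow> L \<in> borel_measurable (Q S)"
    and L0: "\<And>S \<theta>. S \<in> I \<Longrightarrow> \<theta> \<in> space (Q S) \<Longrightarrow> 0 \<le> L \<theta>"
    and Lmax: "\<And>S \<theta>. S \<in> I \<Longrightarrow> \<theta> \<in> space (Q S) \<Longrightarrow> L \<theta> \<le> Lmax S"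
    and Ls: "0 < Ls" and \<alpha>: "0 < \<alpha>" "\<alpha> < 1" and w0: "\<And>S. S \<in> I \<Longrightarrow> 0 \<le> w S"
    and A: "\<And>S. S \<in> I \<Longrightarrow> A \<inter> space (Q S) \<in> sets (Q S)"
    and S\<^sub>0: "S\<^sub>0 \<in> I" and r: "0 < r" "r \<le> 1" and s: "0 < s" "s * Ls \<le> Lmax S\<^sub>0" and m: "0 < m"
    and G: "ennreal m \<le> emeasure (Q S\<^sub>0) {\<theta> \<in> space (Q S\<^sub>0). r * Lmax S\<^sub>0 \<le> L \<theta>}"
    and v: "0 < v" "v \<le> w S\<^sub>0"
  shows "posterior P (\<lambda>\<theta>. L \<theta> / Ls) A \<le>
    (\<Sum>S\<in>I. ennreal (w S) * (\<integral>\<^sup>+\<theta>\<in>A. ennreal ((L \<theta> / Ls) powr \<alpha>) \<partial>Q S)) * ennreal (1 / (v * r * s powr \<alpha> * m))"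
proof -
  obtain k W where k: "0 < k" "k < \<top>"
    and W: "\<And>S. S \<in> I \<Longrightarrow> W S \<in> borel_measurable (Q S)"
    and W_le: "\<And>S \<theta>. S \<in> I \<Longrightarrow> \<theta> \<in> space (Q S) \<Longrightarrow> W S \<theta> \<le> ennreal ((L \<theta> / Ls) powr \<alpha>)"
    and W_ge: "\<And>S \<theta> r. S \<in> I \<Longrightarrow> \<theta> \<in> space (Q S) \<Longrightarrow> 0 < r \<Longrightarrow> r \<le> 1 \<Longrightarrow> r * Lmax S \<le> L \<theta> \<Longrightarrow>
       ennreal (r * (Lmax S / Ls) powr \<alpha>) \<le> W S \<theta>"
    and P: "\<And>g. \<forall>S\<in>I. g \<in> borel_measurable (Q S) \<Longrightarrow>
       (\<integral>\<^sup>+\<theta>. ennreal (L \<theta> / Ls) * g \<theta> \<partial>P) = k * (\<Sum>S\<in>I. ennreal (w S) * (\<integral>\<^sup>+\<theta>. W S \<theta> * g \<theta> \<partial>Q S))"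
    by (rule double_prior_integral[where Q=Q and L=L and Ls=Ls, OF P L L0 Lmax Ls \<alpha> w0])
      (assumption | rule that | blast)+
  define N where "N = (\<Sum>S\<in>I. ennreal (w S) * (\<integral>\<^sup>+\<theta>\<in>A. ennreal ((L \<theta> / Ls) powr \<alpha>) \<partial>Q S))"
  define D where "D = v * r * s powr \<alpha> * m"
  have D: "0 < D" using v r s m by (simp add: D_def)
  have iA: "(indicator A :: 'a \<Rightarrow> ennreal) \<in> borel_measurable (Q S)" if "S \<in> I" for S
    using A[OF that] by (simp add: borel_measurable_indicator_iff)
  have "(\<integral>\<^sup>+\<theta>\<in>A. ennreal (L \<theta> / Ls) \<partial>P) = k * (\<Sum>S\<in>I. ennreal (w S) * (\<integral>\<^sup>+\<theta>\<in>A. W S \<theta> \<partial>Q S))"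
    using iA by (intro P) blast
  also have "\<dots> \<le> k * N"
    unfolding N_def using W_le
    by (intro mult_left_mono sum_mono nn_integral_mono mult_right_mono) auto
  finally have num: "(\<integral>\<^sup>+\<theta>\<in>A. ennreal (L \<theta> / Ls) \<partial>P) \<le> k * N" .
  let ?G = "{\<theta> \<in> space (Q S\<^sub>0). r * Lmax S\<^sub>0 \<le> L \<theta>}"
  have G_sets: "?G \<in> sets (Q S\<^sub>0)" using L[OF S\<^sub>0] by measurable
  have s': "s \<le> Lmax S\<^sub>0 / Ls" using s Ls by (simp add: field_simps)
  have "ennreal D = ennreal v * (ennreal (r * s powr \<alpha>) * ennreal m)"
    using v r m by (simp add: D_def mult.assoc flip: ennreal_mult)
  also have "\<dots> \<le> ennreal (w S\<^sub>0) * (ennreal (r * (Lmax S\<^sub>0 / Ls) powr \<alpha>) * emeasure (Q S\<^sub>0) ?G)"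
    using v r s s' \<alpha> G by (intro mult_mono ennreal_leI powr_mono2) auto
  also have "\<dots> = ennreal (w S\<^sub>0) * (\<integral>\<^sup>+\<theta>\<in>?G. ennreal (r * (Lmax S\<^sub>0 / Ls) powr \<alpha>) \<partial>Q S\<^sub>0)"
    using G_sets by (simp add: nn_integral_cmult_indicator)
  also have "\<dots> \<le> ennreal (w S\<^sub>0) * (\<integral>\<^sup>+\<theta>. W S\<^sub>0 \<theta> * 1 \<partial>Q S\<^sub>0)"
    using W_ge[OF S\<^sub>0] r by (intro mult_left_mono nn_integral_mono) (auto split: split_indicator)
  also have "\<dots> \<le> (\<Sum>S\<in>I. ennreal (w S) * (\<integral>\<^sup>+\<theta>. W S \<theta> * 1 \<partial>Q S))"
    using I S\<^sub>0 by (intro member_le_sum) auto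
  finally have "k * ennreal D \<le> k * (\<Sum>S\<in>I. ennreal (w S) * (\<integral>\<^sup>+\<theta>. W S \<theta> * 1 \<partial>Q S))"
    by (intro mult_left_mono) auto
  also have "\<dots> = (\<integral>\<^sup>+\<theta>. ennreal (L \<theta> / Ls) \<partial>P)"
    using P[of "\<lambda>_. 1"] by simp
  finally have den: "k * ennreal D \<le> (\<integral>\<^sup>+\<theta>. ennreal (L \<theta> / Ls) \<partial>P)" .
  have "0 < k * ennreal D" using k D by (simp add: ennreal_zero_less_mult_iff)
  with den have den0: "0 < (\<integral>\<^sup>+\<theta>. ennreal (L \<theta> / Ls) \<partial>P)" by simp
  \<comment> \<open>Cross-multiplication bounds the quotient and stays valid when the normalizing
    integral is infinite.\<close>
  have "k * N = N * ennreal (1 / D) * (k * ennreal D)"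
    using D by (simp add: mult_ac flip: ennreal_mult)
  also have "\<dots> \<le> N * ennreal (1 / D) * (\<integral>\<^sup>+\<theta>. ennreal (L \<theta> / Ls) \<partial>P)"
    using den by (rule mult_left_mono) simp
  finally have "posterior P (\<lambda>\<theta>. L \<theta> / Ls) A \<le> N * ennreal (1 / D)"
    unfolding posterior_def using num den0
    by (intro divide_le_posI_ennreal) (auto simp: mult.commute)
  then show ?thesis by (simp add: N_def D_def)
qed

section \<open>Posterior concentration\<close>

text \<open>With \<open>b = 1 - 1 / p\<close> and \<open>a * b = \<alpha>\<close>, Hoelder's
  inequality separates the \<open>p\<close>-th power of \<open>\<pi> x\<close> from the
  \<open>a\<close>-th power of the likelihood ratio. The upper limit on \<open>\<alpha>\<close>
  makes \<open>a < 1\<close>, so the mean of the latter is a fractional affinity, which the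
  Hellinger separation makes small.\<close>

lemma likelihood_ratio_moment_le:
  fixes f g \<pi> :: "'x \<Rightarrow> real"
  assumes [measurable]: "f \<in> borel_measurable M" "g \<in> borel_measurable M" "\<pi> \<in> borel_measurable M"
    and f0: "\<And>x. x \<in> space M \<Longrightarrow> 0 \<le> f x" and g0: "\<And>x. x \<in> space M \<Longrightarrow> 0 \<le> g x"
    and f1: "(\<integral>\<^sup>+x. ennreal (f x) \<partial>M) = 1" and g1: "(\<integral>\<^sup>+x. ennreal (g x) \<partial>M) = 1"
    and \<pi>0: "\<And>x. x \<in> space M \<Longrightarrow> 0 \<le> \<pi> x"
    and p: "1 < p" and \<alpha>: "0 < \<alpha>" "\<alpha> < 1 - 1 / p"
    and a: "a = \<alpha> / (1 - 1 / p)"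
    and h: "0 < h" "1 - h < hellinger_sq M f g"
  shows "(\<integral>\<^sup>+x. ennreal (\<pi> x) * ennreal ((g x / f x) powr \<alpha>) \<partial>density M (\<lambda>x. ennreal (f x)))
    \<le> ennreal (h powr (2 * min a (1 - a) * (1 - 1 / p)))
      * ennroot p (\<integral>\<^sup>+x. ennreal (\<pi> x powr p) \<partial>density M (\<lambda>x. ennreal (f x)))"
    (is "_ \<le> ennreal ?h * ennroot p ?I")
\<comment> \<open>An infinite moment makes the right side infinite, because \<open>h\<close> is
  positive; otherwise the moment is a real bound fit for Hoelder's inequality.\<close>
proof (cases "?I = \<top>")
  case True
  then show ?thesis using h by (simp add: ennroot_def ennreal_mult_top)
next
  case False
  let ?P = "density M (\<lambda>x. ennreal (f x))"
  define b where "b = 1 - 1 / p"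
  have b: "0 < b" "b < 1" and b': "1 - b = 1 / p" using p by (auto simp: b_def)
  have a01: "0 < a" "a < 1" and ab: "a * b = \<alpha>" using \<alpha> b unfolding a b_def[symmetric] by auto
  have "(\<integral>\<^sup>+x. ennreal ((g x / f x) powr a) \<partial>?P) = (\<integral>\<^sup>+x. ennreal (f x * (g x / f x) powr a) \<partial>M)"
    using f0 by (subst nn_integral_density) (auto intro!: nn_integral_cong simp: ennreal_mult)
  also have "\<dots> = (\<integral>\<^sup>+x. ennreal (g x powr a * f x powr (1 - a)) \<partial>M)"
  proof (intro nn_integral_cong arg_cong[where f=ennreal])
    fix x assume x: "x \<in> space M"
    show "f x * (g x / f x) powr a = g x powr a * f x powr (1 - a)"
    proof (cases "f x = 0")
      case False
      with f0[OF x] have "0 < f x" by simp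
      then show ?thesis using g0[OF x] by (simp add: powr_divide powr_diff)
    qed simp
  qed
  also have "\<dots> \<le> ennreal ((1 - hellinger_sq M g f) powr (2 * min a (1 - a)))"
    by (intro nn_integral_powr_mult_le_hellinger assms a01)
  \<comment> \<open>The hypothesis on \<open>h\<close> says that the affinity lies below
    \<open>h\<close>; the bound of the squared Hellinger distance by 1 keeps the base of the power
    nonnegative.\<close>
  also have "\<dots> \<le> ennreal (h powr (2 * min a (1 - a)))"
    using h a01 sqrt_mult_integral(2)[OF assms(2,1,5,4,7,6)] hellinger_sq_commute[of M f g]
    by (intro ennreal_leI powr_mono2) auto
  finally have R: "(\<integral>\<^sup>+x. ennreal ((g x / f x) powr a) \<partial>?P) \<le> ennreal (h powr (2 * min a (1 - a)))" .
  have "(\<integral>\<^sup>+x. ennreal (\<pi> x) * ennreal ((g x / f x) powr \<alpha>) \<partial>?P)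
      = (\<integral>\<^sup>+x. ennreal (((g x / f x) powr a) powr b * (\<pi> x powr p) powr (1 - b)) \<partial>?P)"
    using \<pi>0 p by (intro nn_integral_cong) (simp add: powr_powr ab b' mult.commute flip: ennreal_mult)
  also have "\<dots> \<le> ennreal ((h powr (2 * min a (1 - a))) powr b * enn2real ?I powr (1 - b))"
    using R False b by (intro nn_integral_powr_mult_le) (auto simp: less_top)
  also have "\<dots> = ennreal ?h * ennroot p ?I"
    using False by (simp add: ennroot_def b' powr_powr b_def flip: ennreal_mult)
  finally show ?thesis .
qed

section \<open>Measurability in sample and parameter, and averaging over the data\<close>

context empirical_prior_setting
begin

lemma prob_space_data_law:
  assumes "n \<ge> 1" "\<theta> \<in> topspace \<Theta>"
  shows "prob_space (data_law \<mu> dens n \<theta>)"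
  using dens_integral[OF assms] dens_measurable[OF assms] AE_space
  unfolding data_law_def by (intro prob_spaceI) (simp add: emeasure_density cong: nn_integral_cong)

lemma dens_measurable_param:
  assumes "n \<ge> 1" "S \<in> Mod n" "x \<in> space (\<mu> n)"
  shows "(\<lambda>\<theta>. dens n \<theta> x) \<in> borel_measurable (\<nu> n S)"
  using measurable_compose[OF measurable_Pair2'[OF assms(3)] dens_joint_measurable[OF assms(1,2)]]
  by simp

lemma prd_measurable_param:
  assumes "n \<ge> 1" "S \<in> Mod n" "x \<in> space (\<mu> n)"
  shows "(\<lambda>\<theta>. prd n S x \<theta>) \<in> borel_measurable (\<nu> n S)"
  using measurable_compose[OF measurable_Pair2'[OF assms(3)] prd_joint_measurable[OF assms(1,2)]]
  by simp

lemma prd_measurable_data: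
  assumes "n \<ge> 1" "S \<in> Mod n" "\<theta> \<in> \<Theta>m n S"
  shows "(\<lambda>x. prd n S x \<theta>) \<in> borel_measurable (\<mu> n)"
  using measurable_compose[OF measurable_Pair1' prd_joint_measurable[OF assms(1,2)], of \<theta>]
    assms(3) space_\<nu>[OF assms(1,2)] by simp

text \<open>A parameter integral of a jointly measurable function over a sigma-finite measure. It
  makes the set of parameters far from the truth measurable within each model.\<close>

lemma hellinger_sq_measurable:
  assumes n: "n \<ge> 1" and S: "S \<in> Mod n"
  shows "(\<lambda>\<theta>. hellinger_sq (\<mu> n) (dens n \<theta>s) (dens n \<theta>)) \<in> borel_measurable (\<nu> n S)"
proof -
  interpret sigma_finite_measure "\<mu> n" by (rule sigma_finite_\<mu>[OF n])
  note [measurable] = dens_joint_measurable[OF n S] dens_measurable[OF n true_parameter]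
  show ?thesis unfolding hellinger_sq_def by measurable
qed

text \<open>The prior mass is rewritten as an integral over \<open>\<nu> n S\<close> of a jointly
  measurable function of sample and parameter. The event of small local mass is thus measurable and
  can be split off when the posterior is averaged.\<close>

lemma local_prior_mass_measurable:
  assumes n: "n \<ge> 1" and S: "S \<in> Mod n"
  shows "(\<lambda>x. measure (model_prior \<nu> prd n x S)
      {\<theta> \<in> \<Theta>m n S. dens n \<theta> x \<ge> r * dens n (mle n S x) x}) \<in> borel_measurable (\<mu> n)"
proof -
  interpret \<nu>: sigma_finite_measure "\<nu> n S" by (rule sigma_finite_\<nu>[OF n S])
  note dens_joint_measurable[OF n S, measurable] prd_joint_measurable[OF n S, measurable]
    max_likelihood_measurable[OF n S, measurable]
  have [measurable]: "(\<lambda>(x, \<theta>). dens n \<theta> x) \<in> borel_measurable (\<mu> n \<Otimes>\<^sub>M \<nu> n S)"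
    "(\<lambda>(x, \<theta>). prd n S x \<theta>) \<in> borel_measurable (\<mu> n \<Otimes>\<^sub>M \<nu> n S)"
    using dens_joint_measurable[OF n S] prd_joint_measurable[OF n S]
    by (subst measurable_pair_swap_iff; simp add: case_prod_unfold)+
  let ?F = "\<lambda>x. \<integral>\<^sup>+\<theta>. ennreal (prd n S x \<theta>)
    * (if r * dens n (mle n S x) x \<le> dens n \<theta> x then 1 else 0) \<partial>\<nu> n S"
  have "(\<lambda>x. enn2real (?F x)) \<in> borel_measurable (\<mu> n)" by measurable
  moreover have "measure (model_prior \<nu> prd n x S)
      {\<theta> \<in> \<Theta>m n S. dens n \<theta> x \<ge> r * dens n (mle n S x) x} = enn2real (?F x)"
    if x: "x \<in> space (\<mu> n)" for x
  proof -
    note [measurable] = dens_measurable_param[OF n S x] prd_measurable_param[OF n S x]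
    show ?thesis
      unfolding measure_def model_prior_def space_\<nu>[OF n S, symmetric]
      by (subst emeasure_density)
        (auto intro!: arg_cong[where f=enn2real] nn_integral_cong split: split_indicator)
  qed
  ultimately show ?thesis by (simp cong: measurable_cong)
qed

text \<open>Exchanging the expectation with the integral over the parameter allows the moment bound
  to be used at each fixed parameter in \<open>A\<close>; the power of \<open>h\<close> is uniform
  over \<open>A\<close> and comes out of the sum.\<close>

lemma expectation_prior_moment_le:
  assumes n: "n \<ge> 1" and p: "1 < p" and \<alpha>: "0 < \<alpha>" "\<alpha> < 1 - 1 / p"
    and a: "a = \<alpha> / (1 - 1 / p)" and h: "0 < h"
    and A: "A = {\<theta> \<in> (\<Union>S\<in>Mod n. \<Theta>m n S). hellinger_sq (\<mu> n) (dens n \<theta>s) (dens n \<theta>) > 1 - h}"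
  defines "N \<equiv> \<lambda>x. \<Sum>S\<in>Mod n. ennreal (w n S) *
      (\<integral>\<^sup>+\<theta>\<in>A. ennreal ((dens n \<theta> x / dens n \<theta>s x) powr \<alpha>) \<partial>model_prior \<nu> prd n x S)"
  shows "N \<in> borel_measurable (\<mu> n)"
    and "(\<integral>\<^sup>+x. N x \<partial>data_law \<mu> dens n \<theta>s) \<le> ennreal (h powr (2 * min a (1 - a) * (1 - 1 / p))) *
      (\<Sum>S\<in>Mod n. ennreal (w n S) *
         (\<integral>\<^sup>+\<theta>. ennroot p (\<integral>\<^sup>+x. ennreal (prd n S x \<theta> powr p) \<partial>data_law \<mu> dens n \<theta>s) \<partial>\<nu> n S))"
proof -
  let ?P = "data_law \<mu> dens n \<theta>s"
  interpret P: prob_space ?P by (rule prob_space_data_law[OF n true_parameter])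
  have space_P: "space ?P = space (\<mu> n)" and sets_P[measurable_cong]: "sets ?P = sets (\<mu> n)"
    by (simp_all add: data_law_def)
  note [measurable] = dens_measurable[OF n true_parameter]
  \<comment> \<open>The data-dependent prior density becomes part of the integrand, so that the
    remaining reference measure is free of the data and Tonelli's theorem applies.\<close>
  define J where "J S x \<theta> = ennreal (prd n S x \<theta>) *
    (ennreal ((dens n \<theta> x / dens n \<theta>s x) powr \<alpha>) * indicator A \<theta>)" for S x \<theta>
  have A_meas: "(indicator A :: 'a \<Rightarrow> ennreal) \<in> borel_measurable (\<nu> n S)" if S: "S \<in> Mod n" for S
  proof -
    note [measurable] = hellinger_sq_measurable[OF n S]
    have "A \<inter> space (\<nu> n S) = {\<theta> \<in> space (\<nu> n S). hellinger_sq (\<mu> n) (dens n \<theta>s) (dens n \<theta>) > 1 - h}"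
      using S by (auto simp: A space_\<nu>[OF n S])
    also have "\<dots> \<in> sets (\<nu> n S)" by measurable
    finally show ?thesis by (simp add: borel_measurable_indicator_iff)
  qed
  have N_eq: "N x = (\<Sum>S\<in>Mod n. ennreal (w n S) * (\<integral>\<^sup>+\<theta>. J S x \<theta> \<partial>\<nu> n S))" if x: "x \<in> space (\<mu> n)" for x
    unfolding N_def
  proof (intro sum.cong refl arg_cong2[where f="(*)"])
    fix S assume S: "S \<in> Mod n"
    note [measurable] = dens_measurable_param[OF n S x] prd_measurable_param[OF n S x] A_meas[OF S]
    show "(\<integral>\<^sup>+\<theta>\<in>A. ennreal ((dens n \<theta> x / dens n \<theta>s x) powr \<alpha>) \<partial>model_prior \<nu> prd n x S)
        = (\<integral>\<^sup>+\<theta>. J S x \<theta> \<partial>\<nu> n S)"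
      unfolding model_prior_def J_def by (subst nn_integral_density) auto
  qed
  have J_meas: "(\<lambda>(\<theta>, x). J S x \<theta>) \<in> borel_measurable (\<nu> n S \<Otimes>\<^sub>M \<mu> n)" if S: "S \<in> Mod n" for S
  proof -
    note [measurable] = dens_joint_measurable[OF n S] prd_joint_measurable[OF n S] A_meas[OF S]
    show ?thesis unfolding J_def by measurable
  qed
  have J_int: "(\<lambda>x. \<integral>\<^sup>+\<theta>. J S x \<theta> \<partial>\<nu> n S) \<in> borel_measurable (\<mu> n)" if S: "S \<in> Mod n" for S
  proof -
    interpret \<nu>: sigma_finite_measure "\<nu> n S" by (rule sigma_finite_\<nu>[OF n S])
    have "(\<lambda>(x, \<theta>). J S x \<theta>) \<in> borel_measurable (\<mu> n \<Otimes>\<^sub>M \<nu> n S)"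
      using J_meas[OF S] by (subst measurable_pair_swap_iff) (simp add: case_prod_unfold)
    then show ?thesis by (rule \<nu>.borel_measurable_nn_integral)
  qed
  have "(\<lambda>x. \<Sum>S\<in>Mod n. ennreal (w n S) * (\<integral>\<^sup>+\<theta>. J S x \<theta> \<partial>\<nu> n S)) \<in> borel_measurable (\<mu> n)"
    using J_int by (intro borel_measurable_sum borel_measurable_times) auto
  then show "N \<in> borel_measurable (\<mu> n)"
    by (subst measurable_cong[OF N_eq])
  let ?h = "h powr (2 * min a (1 - a) * (1 - 1 / p))"
  let ?E = "\<lambda>S \<theta>. ennroot p (\<integral>\<^sup>+x. ennreal (prd n S x \<theta> powr p) \<partial>?P)"
  have "(\<integral>\<^sup>+x. N x \<partial>?P) = (\<integral>\<^sup>+x. (\<Sum>S\<in>Mod n. ennreal (w n S) * (\<integral>\<^sup>+\<theta>. J S x \<theta> \<partial>\<nu> n S)) \<partial>?P)"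
    by (intro nn_integral_cong) (simp add: N_eq space_P)
  also have "\<dots> = (\<Sum>S\<in>Mod n. ennreal (w n S) * (\<integral>\<^sup>+x. \<integral>\<^sup>+\<theta>. J S x \<theta> \<partial>\<nu> n S \<partial>?P))"
    using J_int by (subst nn_integral_sum) (auto intro!: sum.cong nn_integral_cmult borel_measurable_times
      simp: measurable_cong_sets[OF sets_P refl])
  also have "\<dots> \<le> (\<Sum>S\<in>Mod n. ennreal (w n S) * (ennreal ?h * (\<integral>\<^sup>+\<theta>. ?E S \<theta> \<partial>\<nu> n S)))"
  proof (intro sum_mono mult_left_mono)
    fix S assume S: "S \<in> Mod n"
    interpret \<nu>: sigma_finite_measure "\<nu> n S" by (rule sigma_finite_\<nu>[OF n S])
    interpret pair_sigma_finite "\<nu> n S" ?P ..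
    have "(\<integral>\<^sup>+x. \<integral>\<^sup>+\<theta>. J S x \<theta> \<partial>\<nu> n S \<partial>?P) = (\<integral>\<^sup>+\<theta>. \<integral>\<^sup>+x. J S x \<theta> \<partial>?P \<partial>\<nu> n S)"
      using J_meas[OF S] by (intro Fubini') (simp cong: measurable_cong_sets sets_pair_measure_cong add: sets_P)
    also have "\<dots> \<le> (\<integral>\<^sup>+\<theta>. ennreal ?h * ?E S \<theta> \<partial>\<nu> n S)"
    proof (intro nn_integral_mono)
      fix \<theta> assume "\<theta> \<in> space (\<nu> n S)"
      then have \<theta>: "\<theta> \<in> \<Theta>m n S" by (simp add: space_\<nu>[OF n S])
      then have \<theta>': "\<theta> \<in> topspace \<Theta>" using model_subset[OF n S] by auto
      show "(\<integral>\<^sup>+x. J S x \<theta> \<partial>?P) \<le> ennreal ?h * ?E S \<theta>"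
      proof (cases "\<theta> \<in> A")
        case True
        then have "1 - h < hellinger_sq (\<mu> n) (dens n \<theta>s) (dens n \<theta>)" by (simp add: A)
        then show ?thesis
          using True likelihood_ratio_moment_le[OF dens_measurable[OF n true_parameter]
              dens_measurable[OF n \<theta>'] prd_measurable_data[OF n S \<theta>]
              dens_nonneg[OF n true_parameter] dens_nonneg[OF n \<theta>']
              dens_integral[OF n true_parameter] dens_integral[OF n \<theta>']
              prd_nonneg[OF n S _ \<theta>] p \<alpha> a h]
          by (simp add: J_def data_law_def)
      qed (simp add: J_def)
    qed
    also have "\<dots> = ennreal ?h * (\<integral>\<^sup>+\<theta>. ?E S \<theta> \<partial>\<nu> n S)"
    proof (rule nn_integral_cmult)
      note [measurable] = prd_joint_measurable[OF n S]
      have "(\<lambda>\<theta>. \<integral>\<^sup>+x. ennreal (prd n S x \<theta> powr p) \<partial>?P) \<in> borel_measurable (\<nu> n S)"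
        by measurable
      then show "?E S \<in> borel_measurable (\<nu> n S)" unfolding ennroot_def by measurable
    qed
    finally show "(\<integral>\<^sup>+x. \<integral>\<^sup>+\<theta>. J S x \<theta> \<partial>\<nu> n S \<partial>?P) \<le> ennreal ?h * (\<integral>\<^sup>+\<theta>. ?E S \<theta> \<partial>\<nu> n S)" .
  qed simp
  also have "\<dots> = ennreal ?h * (\<Sum>S\<in>Mod n. ennreal (w n S) * (\<integral>\<^sup>+\<theta>. ?E S \<theta> \<partial>\<nu> n S))"
    by (simp add: sum_distrib_left mult.left_commute)
  finally show "(\<integral>\<^sup>+x. N x \<partial>?P) \<le> ennreal ?h *
      (\<Sum>S\<in>Mod n. ennreal (w n S) * (\<integral>\<^sup>+\<theta>. ?E S \<theta> \<partial>\<nu> n S))" .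
qed

text \<open>Samples are of three kinds. \<open>B1\<close>, where the likelihood ratio at
  \<open>\<theta>\<^sub>0\<close> falls below \<open>exp (- t)\<close>, is controlled by Chebyshev's
  inequality; \<open>B2\<close>, where the local prior mass is below \<open>m\<close>, contributes
  its probability; on all others the bound of \<open>posterior_le\<close> is integrated.\<close>

lemma expected_posterior_le:
  assumes n: "n \<ge> 1" and p: "1 < p" and \<alpha>: "0 < \<alpha>" "\<alpha> < 1 - 1 / p"
    and a: "a = \<alpha> / (1 - 1 / p)" and h: "0 < h"
    and A: "A = {\<theta> \<in> (\<Union>S\<in>Mod n. \<Theta>m n S). hellinger_sq (\<mu> n) (dens n \<theta>s) (dens n \<theta>) > 1 - h}"
    and S\<^sub>0: "S\<^sub>0 \<in> Mod n" and \<theta>\<^sub>0: "\<theta>\<^sub>0 \<in> \<Theta>m n S\<^sub>0"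
    and V: "KL_var (\<mu> n) (dens n \<theta>s) (dens n \<theta>\<^sub>0) \<le> ennreal V" "0 \<le> V" and t: "0 < t"
    and r: "0 < r" "r \<le> 1" and m: "0 < m" and v: "0 < v" "v \<le> w n S\<^sub>0"
    and GP: "(\<Sum>S\<in>Mod n. ennreal (w n S) *
         (\<integral>\<^sup>+\<theta>. ennroot p (\<integral>\<^sup>+x. ennreal (prd n S x \<theta> powr p) \<partial>data_law \<mu> dens n \<theta>s) \<partial>\<nu> n S))
       \<le> ennreal B" and B: "0 \<le> B"
    and prior: "\<And>x. x \<in> space (\<mu> n) \<Longrightarrow>
      type1_prior \<alpha> (Mod n) (w n) (model_prior \<nu> prd n x) (\<lambda>\<theta>. dens n \<theta> x) (P x) \<or>
      type2_prior \<alpha> (Mod n) (w n) (model_prior \<nu> prd n x) (\<lambda>S. dens n (mle n S x) x) (P x)"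
  shows "(\<integral>\<^sup>+x. posterior (P x) (\<lambda>\<theta>. dens n \<theta> x / dens n \<theta>s x) A \<partial>data_law \<mu> dens n \<theta>s)
    \<le> ennreal (V / t\<^sup>2)
      + ennreal (measure (data_law \<mu> dens n \<theta>s) {x \<in> space (\<mu> n). measure (model_prior \<nu> prd n x S\<^sub>0)
           {\<theta> \<in> \<Theta>m n S\<^sub>0. dens n \<theta> x \<ge> r * dens n (mle n S\<^sub>0 x) x} < m})
      + ennreal (h powr (2 * min a (1 - a) * (1 - 1 / p)) * B / (v * r * exp (- t) powr \<alpha> * m))"
proof -
  let ?P = "data_law \<mu> dens n \<theta>s" and ?fs = "dens n \<theta>s" and ?f0 = "dens n \<theta>\<^sub>0"
  let ?Q = "model_prior \<nu> prd n"
  let ?R = "\<lambda>x \<theta>. dens n \<theta> x / ?fs x"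
  interpret P: prob_space ?P by (rule prob_space_data_law[OF n true_parameter])
  have space_P: "space ?P = space (\<mu> n)" and sets_P[measurable_cong]: "sets ?P = sets (\<mu> n)"
    by (simp_all add: data_law_def)
  have \<theta>\<^sub>0': "\<theta>\<^sub>0 \<in> topspace \<Theta>" using \<theta>\<^sub>0 model_subset[OF n S\<^sub>0] by auto
  note meas_s = dens_measurable[OF n true_parameter] and meas_0 = dens_measurable[OF n \<theta>\<^sub>0']
  note [measurable] = meas_s meas_0 local_prior_mass_measurable[OF n S\<^sub>0]
  define B1 where "B1 = {x \<in> space (\<mu> n). ?f0 x < exp (- t) * ?fs x}"
  define B2 where "B2 = {x \<in> space (\<mu> n). measure (?Q x S\<^sub>0)
           {\<theta> \<in> \<Theta>m n S\<^sub>0. dens n \<theta> x \<ge> r * dens n (mle n S\<^sub>0 x) x} < m}"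
  have B12[measurable]: "B1 \<in> sets ?P" "B2 \<in> sets ?P"
    unfolding B1_def B2_def sets_P by measurable
  define N where "N x = (\<Sum>S\<in>Mod n. ennreal (w n S) *
      (\<integral>\<^sup>+\<theta>\<in>A. ennreal (?R x \<theta> powr \<alpha>) \<partial>?Q x S))" for x
  have N_meas[measurable]: "N \<in> borel_measurable ?P"
    using expectation_prior_moment_le(1)[OF n p \<alpha> a h A]
    by (simp add: N_def[abs_def] cong: measurable_cong_sets[OF sets_P])
  define D where "D = v * r * exp (- t) powr \<alpha> * m"
  have D: "0 < D" using v r m by (simp add: D_def)
  have \<alpha>1: "\<alpha> < 1" using \<alpha> p by (smt (verit) divide_pos_pos)
  have space_Q: "space (?Q x S) = \<Theta>m n S" if "S \<in> Mod n" for x S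
    using space_\<nu>[OF n that] by (simp add: model_prior_def)
  have L_meas: "(\<lambda>\<theta>. dens n \<theta> x) \<in> borel_measurable (?Q x S)" if "x \<in> space (\<mu> n)" "S \<in> Mod n" for x S
    using dens_measurable_param[OF n that(2,1)] by (simp add: model_prior_def)
  have L_nonneg: "0 \<le> dens n \<theta> x" if "x \<in> space (\<mu> n)" "S \<in> Mod n" "\<theta> \<in> \<Theta>m n S" for x S \<theta>
    using dens_nonneg[OF n] model_subset[OF n that(2)] that by blast
  have A_sets: "A \<inter> space (?Q x S) \<in> sets (?Q x S)" if "S \<in> Mod n" for x S
  proof -
    note [measurable] = hellinger_sq_measurable[OF n that]
    have "A \<inter> space (\<nu> n S) = {\<theta> \<in> space (\<nu> n S). hellinger_sq (\<mu> n) ?fs (dens n \<theta>) > 1 - h}"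
      using that by (auto simp: A space_\<nu>[OF n that])
    also have "\<dots> \<in> sets (\<nu> n S)" by measurable
    finally show ?thesis by (simp add: model_prior_def)
  qed
  have bound: "posterior (P x) (?R x) A \<le> indicator B1 x + indicator B2 x + N x * ennreal (1 / D)"
    if x: "x \<in> space (\<mu> n)" and pos: "0 < ?fs x" for x
  proof (cases "x \<in> B1 \<or> x \<in> B2")
    case True
    \<comment> \<open>Scaling and reweighting by a density leave the measurable sets unchanged, so
      under either regularization they are those of a mixture.\<close>
    have "\<exists>wt. sets (P x) = sets (mixture_measure (Mod n) wt (?Q x))"
      using prior[OF x] unfolding type1_prior_def type2_prior_def by auto
    then obtain wt where "sets (P x) = sets (mixture_measure (Mod n) wt (?Q x))" ..
    moreover have "?R x \<in> borel_measurable (mixture_measure (Mod n) wt (?Q x))"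
      by (intro measurable_mixture_measure borel_measurable_divide L_meas x) auto
    ultimately have "?R x \<in> borel_measurable (P x)"
      by (simp cong: measurable_cong_sets)
    from posterior_le_1[OF this] have "posterior (P x) (?R x) A \<le> 1" .
    also have "\<dots> \<le> indicator B1 x + indicator B2 x"
      using True by (auto split: split_indicator)
    finally show ?thesis by (rule order_trans) simp
  next
    case False
    let ?G = "{\<theta> \<in> \<Theta>m n S\<^sub>0. r * dens n (mle n S\<^sub>0 x) x \<le> dens n \<theta> x}"
    \<comment> \<open>Off \<open>B1\<close> the likelihood at \<open>\<theta>\<^sub>0\<close>, and
      with it the maximum over the model, is large enough to take \<open>s = exp (- t)\<close> in
      \<open>posterior_le\<close>.\<close>
    have "exp (- t) * ?fs x \<le> ?f0 x" using False x by (auto simp: B1_def)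
    also have "\<dots> \<le> dens n (mle n S\<^sub>0 x) x" using mle_max[OF n S\<^sub>0 x \<theta>\<^sub>0] .
    finally have s: "exp (- t) * ?fs x \<le> dens n (mle n S\<^sub>0 x) x" .
    have "m \<le> measure (?Q x S\<^sub>0) ?G" using False x by (auto simp: B2_def)
    then have "ennreal m \<le> emeasure (?Q x S\<^sub>0) ?G"
      unfolding measure_def by (metis ennreal_enn2real_if ennreal_leI top_greatest)
    then have G: "ennreal m \<le> emeasure (?Q x S\<^sub>0) {\<theta> \<in> space (?Q x S\<^sub>0).
        r * dens n (mle n S\<^sub>0 x) x \<le> dens n \<theta> x}"
      by (simp add: space_Q[OF S\<^sub>0])
    have "posterior (P x) (?R x) A \<le> N x * ennreal (1 / D)"
      unfolding N_def D_def using \<alpha>1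
      by (intro posterior_le[where Lmax="\<lambda>S. dens n (mle n S x) x" and Q="?Q x" and S\<^sub>0=S\<^sub>0,
            OF prior[OF x]] G s A_sets)
        (auto simp: space_Q finite_models[OF n] w_nonneg[OF n] S\<^sub>0 pos \<alpha> r m v
          intro: L_meas L_nonneg x mle_max[OF n _ x])
    then show ?thesis by (rule order_trans) simp
  qed
  have "(\<integral>\<^sup>+x. posterior (P x) (?R x) A \<partial>?P)
      \<le> (\<integral>\<^sup>+x. indicator B1 x + indicator B2 x + N x * ennreal (1 / D) \<partial>?P)"
  proof (rule nn_integral_mono_AE)
    \<comment> \<open>The zero set of a density is null under the law it defines, so dividing by the
      true likelihood is legitimate almost surely.\<close>
    have "AE x in ?P. 0 < ?fs x"
      unfolding data_law_def by (subst AE_density) auto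
    then show "AE x in ?P. posterior (P x) (?R x) A \<le> indicator B1 x + indicator B2 x + N x * ennreal (1 / D)"
      using AE_space by eventually_elim (use bound space_P in auto)
  qed
  also have "\<dots> = emeasure ?P B1 + emeasure ?P B2 + (\<integral>\<^sup>+x. N x \<partial>?P) * ennreal (1 / D)"
    by (simp add: nn_integral_add nn_integral_multc)
  also have "\<dots> \<le> ennreal (V / t\<^sup>2) + ennreal (measure ?P B2)
      + ennreal (h powr (2 * min a (1 - a) * (1 - 1 / p))) * ennreal B * ennreal (1 / D)"
  proof (intro add_mono mult_right_mono)
    show "emeasure ?P B1 \<le> ennreal (V / t\<^sup>2)"
      unfolding B1_def data_law_def
      by (intro small_likelihood_ratio_le meas_s meas_0 V t dens_nonneg[OF n] true_parameter \<theta>\<^sub>0')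
    show "(\<integral>\<^sup>+x. N x \<partial>?P) \<le> ennreal (h powr (2 * min a (1 - a) * (1 - 1 / p))) * ennreal B"
      unfolding N_def
      using expectation_prior_moment_le(2)[OF n p \<alpha> a h A] GP
      by (meson mult_left_mono order_trans zero_le)
  qed (simp_all add: P.emeasure_eq_measure)
  also have "ennreal (h powr (2 * min a (1 - a) * (1 - 1 / p))) * ennreal B * ennreal (1 / D)
      = ennreal (h powr (2 * min a (1 - a) * (1 - 1 / p)) * B / D)"
    using B D by (simp flip: ennreal_mult)
  finally show ?thesis by (simp add: B2_def D_def)
qed

end

section \<open>Choice of constants and passage to the limit\<close>

theorem theorem2:
  fixes \<mu> :: "nat \<Rightarrow> 'x measure"
    and dens :: "nat \<Rightarrow> 'a \<Rightarrow> 'x \<Rightarrow> real"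
    and \<Theta> :: "'a topology" and \<theta>s :: 'a
    and Mod :: "nat \<Rightarrow> 's set" and \<Theta>m :: "nat \<Rightarrow> 's \<Rightarrow> 'a set" and dm :: "'s \<Rightarrow> nat"
    and w :: "nat \<Rightarrow> 's \<Rightarrow> real"
    and \<nu> :: "nat \<Rightarrow> 's \<Rightarrow> 'a measure"
    and prd :: "nat \<Rightarrow> 's \<Rightarrow> 'x \<Rightarrow> 'a \<Rightarrow> real"
    and mle :: "nat \<Rightarrow> 's \<Rightarrow> 'x \<Rightarrow> 'a"
    and \<epsilon> :: "nat \<Rightarrow> real"
    and Sd :: "nat \<Rightarrow> 's" and \<theta>d :: "nat \<Rightarrow> 'a"
    and d A C K p \<alpha> :: real
    and \<Pi>t :: "nat \<Rightarrow> 'x \<Rightarrow> 'a measure"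
  assumes setting: "empirical_prior_setting \<mu> dens \<Theta> \<theta>s Mod \<Theta>m dm w \<nu> prd mle"
    and eps_pos: "\<And>n. n \<ge> 1 \<Longrightarrow> \<epsilon> n > 0"
    and eps_lim: "\<epsilon> \<longlonglongrightarrow> 0"
    and n_eps_lim: "filterlim (\<lambda>n. real n * (\<epsilon> n)\<^sup>2) at_top sequentially"
    and S2_mem: "\<And>n. n \<ge> 1 \<Longrightarrow> Sd n \<in> Mod n \<and> \<theta>d n \<in> \<Theta>m n (Sd n)"
    and S2_dim: "\<forall>\<^sub>F n in sequentially. real (dm (Sd n)) \<le> real n * (\<epsilon> n)\<^sup>2"
    and S2_KL: "\<forall>\<^sub>F n in sequentially.
        max (KL (\<mu> n) (dens n \<theta>s) (dens n (\<theta>d n)))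
            (enn2ereal (KL_var (\<mu> n) (dens n \<theta>s) (dens n (\<theta>d n))))
          \<le> ereal (real n * (\<epsilon> n)\<^sup>2)"
    and LP2_const: "d > 0" "A > 0" "C > 0"
    and LP2_local: "(\<lambda>n. measure (data_law \<mu> dens n \<theta>s)
          {x \<in> space (\<mu> n).
             measure (model_prior \<nu> prd n x (Sd n))
               {\<theta> \<in> \<Theta>m n (Sd n).
                  dens n \<theta> x \<ge> exp (- d * real (dm (Sd n))) * dens n (mle n (Sd n) x) x}
             < exp (- C * real n * (\<epsilon> n)\<^sup>2)}) \<longlonglongrightarrow> 0"
    and LP2_weight: "\<exists>c>0. \<forall>\<^sub>F n in sequentially. w n (Sd n) \<ge> c * exp (- A * real n * (\<epsilon> n)\<^sup>2)"
    and GP2_const: "K \<ge> 0" "p > 1"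
    and GP2: "\<exists>B>0. \<forall>\<^sub>F n in sequentially.
        (\<Sum>S\<in>Mod n. ennreal (w n S) *
           (\<integral>\<^sup>+\<theta>. ennroot p (\<integral>\<^sup>+x. ennreal (prd n S x \<theta> powr p) \<partial>data_law \<mu> dens n \<theta>s) \<partial>\<nu> n S))
          \<le> ennreal (B * exp (K * real n * (\<epsilon> n)\<^sup>2))"
    and alpha: "0 < \<alpha>" "\<alpha> < 1 - 1 / p"
    and double_empirical_prior:
      "(\<forall>n\<ge>1. \<forall>x\<in>space (\<mu> n).
          type1_prior \<alpha> (Mod n) (w n) (model_prior \<nu> prd n x) (\<lambda>\<theta>. dens n \<theta> x) (\<Pi>t n x)) \<or>
       (\<forall>n\<ge>1. \<forall>x\<in>space (\<mu> n).
          type2_prior \<alpha> (Mod n) (w n) (model_prior \<nu> prd n x) (\<lambda>S. dens n (mle n S x) x) (\<Pi>t n x))"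
  shows "\<exists>M>0. (\<lambda>n. \<integral>\<^sup>+x.
            posterior (\<Pi>t n x) (\<lambda>\<theta>. dens n \<theta> x / dens n \<theta>s x)
              {\<theta> \<in> (\<Union>S\<in>Mod n. \<Theta>m n S).
                 hellinger_sq (\<mu> n) (dens n \<theta>s) (dens n \<theta>) > 1 - exp (- M\<^sup>2 * real n * (\<epsilon> n)\<^sup>2)}
            \<partial>data_law \<mu> dens n \<theta>s) \<longlonglongrightarrow> 0"
proof -
  interpret empirical_prior_setting \<mu> dens \<Theta> \<theta>s Mod \<Theta>m dm w \<nu> prd mle by (rule setting)
  define u where "u n = real n * (\<epsilon> n)\<^sup>2" for n
  define a where "a = \<alpha> / (1 - 1 / p)"
  \<comment> \<open>\<open>\<kappa>\<close> is the power of \<open>h\<close> in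
    \<open>expected_posterior_le\<close>; it is positive because \<open>\<alpha> < 1 - 1 / p\<close>
    puts \<open>a\<close> strictly between 0 and 1.\<close>
  define \<kappa> where "\<kappa> = 2 * min a (1 - a) * (1 - 1 / p)"
  have p1: "0 < 1 - 1 / p" using GP2_const by simp
  have "0 < a" "a < 1" using alpha p1 by (simp_all add: a_def)
  then have \<kappa>: "0 < \<kappa>" using p1 by (simp add: \<kappa>_def)
  \<comment> \<open>The exponents to be beaten are \<open>K\<close> from the prior moments,
    \<open>A\<close> from the model weight, \<open>C\<close> from the local mass, \<open>d\<close>
    from near-maximality and \<open>\<alpha>\<close> from Chebyshev's threshold. The extra 1 leaves
    a factor \<open>exp (- u n)\<close>.\<close>
  define M where "M = sqrt ((K + A + C + d + \<alpha> + 1) / \<kappa>)"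
  have "0 < (K + A + C + d + \<alpha> + 1) / \<kappa>"
    using GP2_const LP2_const alpha \<kappa> by simp
  then have M: "0 < M" and M2: "M\<^sup>2 * \<kappa> = K + A + C + d + \<alpha> + 1"
    using \<kappa> by (simp_all add: M_def)
  obtain c where c: "0 < c" and weight: "\<forall>\<^sub>F n in sequentially. w n (Sd n) \<ge> c * exp (- A * real n * (\<epsilon> n)\<^sup>2)"
    using LP2_weight by blast
  obtain B where B: "0 < B" and GP: "\<forall>\<^sub>F n in sequentially.
        (\<Sum>S\<in>Mod n. ennreal (w n S) *
           (\<integral>\<^sup>+\<theta>. ennroot p (\<integral>\<^sup>+x. ennreal (prd n S x \<theta> powr p) \<partial>data_law \<mu> dens n \<theta>s) \<partial>\<nu> n S))
          \<le> ennreal (B * exp (K * real n * (\<epsilon> n)\<^sup>2))"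
    using GP2 by blast
  let ?\<Pi> = "\<lambda>n. \<integral>\<^sup>+x. posterior (\<Pi>t n x) (\<lambda>\<theta>. dens n \<theta> x / dens n \<theta>s x)
              {\<theta> \<in> (\<Union>S\<in>Mod n. \<Theta>m n S).
                 hellinger_sq (\<mu> n) (dens n \<theta>s) (dens n \<theta>) > 1 - exp (- M\<^sup>2 * real n * (\<epsilon> n)\<^sup>2)}
            \<partial>data_law \<mu> dens n \<theta>s"
  let ?m = "\<lambda>n. measure (data_law \<mu> dens n \<theta>s) {x \<in> space (\<mu> n). measure (model_prior \<nu> prd n x (Sd n))
               {\<theta> \<in> \<Theta>m n (Sd n). dens n \<theta> x \<ge> exp (- d * real (dm (Sd n))) * dens n (mle n (Sd n) x) x}
             < exp (- C * real n * (\<epsilon> n)\<^sup>2)}"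
  \<comment> \<open>The first term is Chebyshev's bound \<open>V / t\<^sup>2\<close> with both
    \<open>V\<close> and \<open>t\<close> equal to \<open>u n\<close>.\<close>
  let ?bd = "\<lambda>n. 1 / u n + ?m n + B / c * exp (- u n)"
  have le: "\<forall>\<^sub>F n in sequentially. ?\<Pi> n \<le> ennreal (?bd n)"
    using weight GP S2_dim S2_KL eventually_ge_at_top[of 1]
  proof eventually_elim
    case (elim n)
    then have n: "n \<ge> 1" by simp
    have u: "0 < u n" using eps_pos[OF n] n by (simp add: u_def)
    have "enn2ereal (KL_var (\<mu> n) (dens n \<theta>s) (dens n (\<theta>d n))) \<le> ereal (u n)"
      using elim(4) by (simp add: u_def)
    then have V: "KL_var (\<mu> n) (dens n \<theta>s) (dens n (\<theta>d n)) \<le> ennreal (u n)"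
      using u by (simp add: less_eq_ennreal.rep_eq enn2ereal_ennreal)
    let ?h = "exp (- M\<^sup>2 * real n * (\<epsilon> n)\<^sup>2)" and ?v = "c * exp (- A * real n * (\<epsilon> n)\<^sup>2)"
      and ?r = "exp (- d * real (dm (Sd n)))" and ?e = "exp (- C * real n * (\<epsilon> n)\<^sup>2)"
      and ?B = "B * exp (K * real n * (\<epsilon> n)\<^sup>2)"
    have bd: "?h powr \<kappa> * ?B / (?v * ?r * exp (- u n) powr \<alpha> * ?e) \<le> B / c * exp (- u n)"
    proof -
      \<comment> \<open>The dimension bound on the model \<open>Sd n\<close> turns the loss from
        near-maximality into a power of \<open>exp (u n)\<close>.\<close>
      have "exp (- d * u n) \<le> ?r" using elim(3) LP2_const by (simp add: u_def)
      then have "?h powr \<kappa> * ?B / (?v * ?r * exp (- u n) powr \<alpha> * ?e)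
          \<le> ?h powr \<kappa> * ?B / (?v * exp (- d * u n) * exp (- u n) powr \<alpha> * ?e)"
        using c B by (intro divide_left_mono mult_right_mono mult_left_mono mult_pos_pos) auto
      also have "\<dots> = B / c * (exp (- (M\<^sup>2 * \<kappa>) * u n) * exp (K * u n) /
          (exp (- A * u n) * exp (- d * u n) * exp (- \<alpha> * u n) * exp (- C * u n)))"
        by (simp add: u_def exp_powr_real mult_ac)
      also have "exp (- (M\<^sup>2 * \<kappa>) * u n) * exp (K * u n) /
          (exp (- A * u n) * exp (- d * u n) * exp (- \<alpha> * u n) * exp (- C * u n)) = exp (- u n)"
        unfolding M2 by (simp flip: exp_add exp_diff) (simp add: algebra_simps)
      finally show ?thesis .
    qed
    have "?\<Pi> n \<le> ennreal (u n / (u n)\<^sup>2) + ennreal (?m n)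
        + ennreal (?h powr \<kappa> * ?B / (?v * ?r * exp (- u n) powr \<alpha> * ?e))"
      unfolding \<kappa>_def
    proof (rule expected_posterior_le[OF n GP2_const(2) alpha a_def _ refl _ _ V])
      fix x assume "x \<in> space (\<mu> n)"
      then show "type1_prior \<alpha> (Mod n) (w n) (model_prior \<nu> prd n x) (\<lambda>\<theta>. dens n \<theta> x) (\<Pi>t n x) \<or>
        type2_prior \<alpha> (Mod n) (w n) (model_prior \<nu> prd n x) (\<lambda>S. dens n (mle n S x) x) (\<Pi>t n x)"
        using double_empirical_prior n by blast
    qed (use S2_mem[OF n] u c B elim LP2_const in \<open>simp_all\<close>)
    also have "\<dots> \<le> ennreal (u n / (u n)\<^sup>2) + ennreal (?m n) + ennreal (B / c * exp (- u n))"
      using bd by (intro add_left_mono ennreal_leI)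
    also have "\<dots> = ennreal (?bd n)"
      using u B c by (simp add: power2_eq_square)
    finally show ?case .
  qed
  have lim: "(\<lambda>n. ennreal (?bd n)) \<longlonglongrightarrow> 0"
  proof -
    have u: "filterlim u at_top sequentially" using n_eps_lim by (simp add: u_def[abs_def])
    have "(\<lambda>n. 1 / u n) \<longlonglongrightarrow> 0"
      using u by (intro real_tendsto_divide_at_top[OF tendsto_const])
    moreover have "(\<lambda>n. exp (- u n)) \<longlonglongrightarrow> 0"
      using u by (intro filterlim_compose[OF exp_at_bot] filterlim_compose[OF filterlim_uminus_at_bot_at_top])
    ultimately have "?bd \<longlonglongrightarrow> 0 + 0 + B / c * 0"
      using LP2_local by (intro tendsto_add tendsto_mult tendsto_const)
    from tendsto_ennrealI[OF this] show ?thesis by simp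
  qed
  have "?\<Pi> \<longlonglongrightarrow> 0"
    by (rule tendsto_sandwich[OF always_eventually le tendsto_const lim]) simp
  with M have "0 < M \<and> ?\<Pi> \<longlonglongrightarrow> 0" by (rule conjI)
  then show ?thesis by (rule exI[of _ M])
qed

end
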